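(* Consider the scan-and-move sensing model described in the context, with the field assumption and the noise/motion assumption in force, and fix $\lambda>0$. Let $k$ be any episode, let $\delta_k\in(0,1)$, and let $\mathcal C_{k,n}$, $n\ge1$, be the gradient confidence sets defined in the context. Then $$\mathbb{P}\Big(\nabla F(p_k)\in\mathcal C_{k,n}\ \text{for all } n\geq1\ \Big|\ \mathcal F_{k,0}\Big)\ \geq\ 1-\delta_k,$$ where the gradient $\nabla F(p_k)$ is expressed in the episode-local frame. Since the guarantee holds for all $n$ simultaneously, the confidence set remains valid at any stopping time $\tau_k$, i.e. $\nabla F(p_k)\in\mathcal C_{k,\tau_k}$ on this event.
   Context: Field assumption: $F:\mathbb{R}^2\to\mathbb{R}$ is $C^3$, has a unique global minimizer $p^\star$, which is its only stationary point; $\{p:F(p)\le F(p_0)\}$ is compact for the initial position $p_0$; there are known constants $G,L,M_3>0$ with $\|\nabla F(p)\|\le G$, $\|\nabla F(p)-\nabla F(\bar p)\|\le L\|p-\bar p\|$, $\|D^3F(p)\|\le M_3$ (operator norm of the trilinear form) for all $p,\bar p\in\mathbb{R}^2$; and $F(p_0)-F(p^\star)\le\Delta_0$ for a known $\Delta_0>0$. Sensing model: write $\varphi(\theta)=[\cos\theta\ \ \sin\theta]^\top$. A scalar sensor is mounted at distance $\rho>0$ from the robot center. Motion is organized in episodes $k=0,1,2,\dots$. During the scan of episode $k$ the robot center is fixed at $p_k\in\mathbb{R}^2$, with heading $\theta_k$ at the start of the episode. The $i$th measurement ($i\ge1$), taken at relative bearing $\alpha_{k,i}$, is $$\mathsf{y}_{k,i}=F\big(p_k+\rho\varphi(\theta_k+\alpha_{k,i})\big)+w_{k,i}.$$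 $\mathcal F_{k,i}$ is the information ($\sigma$-algebra) generated by all relative bearings and measurements up to sample $i$ of episode $k$, including all previous episodes; $\mathcal F_{k,0}$ is the information available at the beginning of episode $k$, and $p_k,\theta_k$ are $\mathcal F_{k,0}$-measurable. Noise/motion assumption: for all $k,i$, $\mathbb{E}[w_{k,i}\mid\mathcal F_{k,i-1}]=0$ and $\mathbb{E}[e^{s w_{k,i}}\mid\mathcal F_{k,i-1}]\le\exp(s^2\sigma^2/2)$ for all $s\in\mathbb{R}$, with known variance proxy $\sigma^2$; $\alpha_{k,i}$ is $\mathcal F_{k,i-1}$-measurable; during each scan the center is held fixed and after the scan the commanded rotation and translation are executed. Episode-local frame: the frame centered at $p_k$ rotated by $\theta_k$; a gradient expressed in this frame is $R(\theta_k)^\top\nabla F(p_k)$, where $R(\theta)$ is the counterclockwise rotation matrix by angle $\theta$. Estimator: let $z(\alpha)=[\cos\alpha\ \sin\alpha\ \cos2\alpha\ \sin2\alpha]^\top$, $\psi_{k,1}=e_1=[1\ 0\ 0\ 0\ 0]^\top$ and $\psi_{k,i}=\begin{bmatrix}1\\ z(\alpha_{k,i})-z(\alpha_{k,1})\end{bmatrix}\in\mathbb{R}^5$ for $i\ge2$. Let $\Lambda_\lambda=\operatorname{diag}(0,\lambda I_4)$, $$V_{k,n}=\Lambda_\lambda+\sum_{i=1}^n\psi_{k,i}\psi_{k,i}^\top,\qquad \hat\vartheta_{k,n}=V_{k,n}^{-1}\sum_{i=1}^n\psi_{k,i}\mathsf{y}_{k,i},$$ $$G_\rho=\tfrac1\rho\begin{bmatrix}0&I_2&0_{2\times2}\end{bmatrix}\in\mathbb{R}^{2\times5},\qquad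 \hat g_{k,n}=G_\rho\hat\vartheta_{k,n},\qquad P_{k,n}=G_\rho V_{k,n}^{-1}G_\rho^\top .$$ ($V_{k,n}$ is positive definite for every $n\ge1$.) Confidence set: let $S_\xi=\sqrt{\rho^2G^2+\rho^4L^2/4}$, $b_\rho=M_3\rho^3/6$, $$\beta_{k,n}=\sigma\sqrt{2\log\frac{4}{\delta_k}}+\sigma\sqrt{2\log\!\left(\frac{2\det(V_{k,n})^{1/2}}{\delta_k\det(V_{k,1})^{1/2}}\right)}+\sqrt{\lambda}\,S_\xi+b_\rho\sqrt n,$$ $$\mathcal C_{k,n}=\left\{g\in\mathbb{R}^2:(g-\hat g_{k,n})^\top P_{k,n}^{-1}(g-\hat g_{k,n})\le\beta_{k,n}^2\right\}.$$ *)

theory Defs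
  imports "HOL-Probability.Probability"
begin

definition fderiv :: "('a::real_normed_vector \<Rightarrow> 'b::real_normed_vector) \<Rightarrow> 'a \<Rightarrow> 'a \<Rightarrow>\<^sub>L 'b" where
  "fderiv f x = Blinfun (frechet_derivative f (at x))"

definition C3_field :: "(real^2 \<Rightarrow> real) \<Rightarrow> bool" where
  "C3_field F \<longleftrightarrow>
     F differentiable_on UNIV \<and>
     fderiv F differentiable_on UNIV \<and>
     fderiv (fderiv F) differentiable_on UNIV \<and>
     continuous_on UNIV (fderiv (fderiv (fderiv F)))"

definition grad :: "(real^2 \<Rightarrow> real) \<Rightarrow> real^2 \<Rightarrow> real^2" where
  "grad F x = (\<chi> i. frechet_derivative F (at x) (axis i 1))"

text \<open>The norm of the iterated derivative in \<open>V \<Rightarrow>\<^sub>L V \<Rightarrow>\<^sub>L V \<Rightarrow>\<^sub>L \<real>\<close> is the operator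
  norm of the associated trilinear form, because the nested suprema over unit vectors
  combine into one.\<close>

definition field_assumption ::
  "(real^2 \<Rightarrow> real) \<Rightarrow> real^2 \<Rightarrow> real^2 \<Rightarrow> real \<Rightarrow> real \<Rightarrow> real \<Rightarrow> real \<Rightarrow> bool" where
  "field_assumption F p0 pstar G L M3 \<Delta>0 \<longleftrightarrow>
     C3_field F \<and>
     (\<forall>x. x \<noteq> pstar \<longrightarrow> F pstar < F x) \<and>
     (\<forall>x. grad F x = 0 \<longleftrightarrow> x = pstar) \<and>
     compact {x. F x \<le> F p0} \<and>
     0 < G \<and> (\<forall>x. norm (grad F x) \<le> G) \<and>
     0 < L \<and> (\<forall>x x'. norm (grad F x - grad F x') \<le> L * norm (x - x')) \<and>
     0 < M3 \<and> (\<forall>x. norm (fderiv (fderiv (fderiv F)) x) \<le> M3) \<and>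
     0 < \<Delta>0 \<and> F p0 - F pstar \<le> \<Delta>0"

definition phi :: "real \<Rightarrow> real^2" where
  "phi \<theta> = vector [cos \<theta>, sin \<theta>]"

definition rotation :: "real \<Rightarrow> real^2^2" where
  "rotation \<theta> = vector [vector [cos \<theta>, - sin \<theta>], vector [sin \<theta>, cos \<theta>]]"

definition local_grad :: "(real^2 \<Rightarrow> real) \<Rightarrow> real^2 \<Rightarrow> real \<Rightarrow> real^2" where
  "local_grad F x \<theta> = transpose (rotation \<theta>) *v grad F x"

text \<open>Bearings and measurements are indexed by episode and sample, samples counting from 1.
  \<open>\<tau> j\<close> is the length of the scan of episode \<open>j\<close>: once that episode is over, only its samples
  \<open>i \<le> \<tau> j\<close> belong to the recorded history, and the value \<open>\<infinity>\<close> records all of them.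
  \<open>H\<close> is the information available before the first episode; it may be trivial.\<close>

definition info ::
  "'w measure \<Rightarrow> 'w measure \<Rightarrow> (nat \<Rightarrow> 'w \<Rightarrow> enat) \<Rightarrow> (nat \<Rightarrow> nat \<Rightarrow> 'w \<Rightarrow> real) \<Rightarrow>
   (nat \<Rightarrow> nat \<Rightarrow> 'w \<Rightarrow> real) \<Rightarrow> nat \<Rightarrow> nat \<Rightarrow> 'w measure" where
  "info M H \<tau> \<alpha> y k n = sigma (space M)
     (sets H
      \<union> {{\<omega> \<in> space M. enat i \<le> \<tau> j \<omega> \<and> (\<alpha> j i \<omega>, y j i \<omega>) \<in> A} | j i A.
           j < k \<and> 1 \<le> i \<and> A \<in> sets borel}
      \<union> {{\<omega> \<in> space M. (\<alpha> k i \<omega>, y k i \<omega>) \<in> A} | i A.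
           1 \<le> i \<and> i \<le> n \<and> A \<in> sets borel})"

text \<open>Unlike \<^const>\<open>stopping_time\<close>, the time may be infinite while the filtration is
  indexed by \<^typ>\<open>nat\<close>.\<close>

definition scan_stopping_time :: "(nat \<Rightarrow> 'w measure) \<Rightarrow> ('w \<Rightarrow> enat) \<Rightarrow> bool" where
  "scan_stopping_time Filt T \<longleftrightarrow> (\<forall>n. Measurable.pred (Filt n) (\<lambda>\<omega>. T \<omega> \<le> enat n))"

text \<open>Here \<open>a\<close> and \<open>y\<close> are the bearings and measurements of a single scan. Indices of
  \<^typ>\<open>real^5\<close> are numbered 1 to 5, where \<open>5 = 0\<close> in the index type.\<close>

definition zvec :: "real \<Rightarrow> real^4" where
  "zvec a = vector [cos a, sin a, cos (2 * a), sin (2 * a)]"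

definition psi :: "(nat \<Rightarrow> real) \<Rightarrow> nat \<Rightarrow> real^5" where
  "psi a i =
     (if i = 1 then vector [1, 0, 0, 0, 0]
      else let d = zvec (a i) - zvec (a 1) in vector [1, d $ 1, d $ 2, d $ 3, d $ 4])"

definition Lambda :: "real \<Rightarrow> real^5^5" where
  "Lambda lam = (\<chi> i j. if i = j \<and> i \<noteq> 1 then lam else 0)"

definition Vmat :: "real \<Rightarrow> (nat \<Rightarrow> real) \<Rightarrow> nat \<Rightarrow> real^5^5" where
  "Vmat lam a n = Lambda lam + (\<Sum>i=1..n. \<chi> r c. psi a i $ r * psi a i $ c)"

definition est :: "real \<Rightarrow> (nat \<Rightarrow> real) \<Rightarrow> (nat \<Rightarrow> real) \<Rightarrow> nat \<Rightarrow> real^5" where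
  "est lam a y n = matrix_inv (Vmat lam a n) *v (\<Sum>i=1..n. y i *\<^sub>R psi a i)"

definition Gmat :: "real \<Rightarrow> real^5^2" where
  "Gmat \<rho> = (1 / \<rho>) *\<^sub>R vector [vector [0, 1, 0, 0, 0], vector [0, 0, 1, 0, 0]]"

definition ghat :: "real \<Rightarrow> real \<Rightarrow> (nat \<Rightarrow> real) \<Rightarrow> (nat \<Rightarrow> real) \<Rightarrow> nat \<Rightarrow> real^2" where
  "ghat \<rho> lam a y n = Gmat \<rho> *v est lam a y n"

definition Pmat :: "real \<Rightarrow> real \<Rightarrow> (nat \<Rightarrow> real) \<Rightarrow> nat \<Rightarrow> real^2^2" where
  "Pmat \<rho> lam a n = Gmat \<rho> ** matrix_inv (Vmat lam a n) ** transpose (Gmat \<rho>)"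

text \<open>By Taylor expansion the field on the sensing circle is a trigonometric polynomial of
  degree 2 whose four non-constant coefficients have norm at most \<open>S_xi\<close>, up to a remainder
  bounded by \<open>bias_bound\<close>.\<close>

definition S_xi :: "real \<Rightarrow> real \<Rightarrow> real \<Rightarrow> real" where
  "S_xi \<rho> G L = sqrt (\<rho>^2 * G^2 + \<rho>^4 * L^2 / 4)"

definition bias_bound :: "real \<Rightarrow> real \<Rightarrow> real" where
  "bias_bound \<rho> M3 = M3 * \<rho>^3 / 6"

definition radius ::
  "real \<Rightarrow> real \<Rightarrow> real \<Rightarrow> real \<Rightarrow> real \<Rightarrow> real \<Rightarrow> real \<Rightarrow> (nat \<Rightarrow> real) \<Rightarrow> nat \<Rightarrow> real" where
  "radius \<rho> lam \<sigma> G L M3 \<delta> a n =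
     \<sigma> * sqrt (2 * ln (4 / \<delta>))
     + \<sigma> * sqrt (2 * ln (2 * sqrt (det (Vmat lam a n)) / (\<delta> * sqrt (det (Vmat lam a 1)))))
     + sqrt lam * S_xi \<rho> G L
     + bias_bound \<rho> M3 * sqrt (real n)"

definition conf_set ::
  "real \<Rightarrow> real \<Rightarrow> real \<Rightarrow> real \<Rightarrow> real \<Rightarrow> real \<Rightarrow> real \<Rightarrow>
   (nat \<Rightarrow> real) \<Rightarrow> (nat \<Rightarrow> real) \<Rightarrow> nat \<Rightarrow> (real^2) set" where
  "conf_set \<rho> lam \<sigma> G L M3 \<delta> a y n =
     {g. (g - ghat \<rho> lam a y n) \<bullet> (matrix_inv (Pmat \<rho> lam a n) *v (g - ghat \<rho> lam a y n))
         \<le> (radius \<rho> lam \<sigma> G L M3 \<delta> a n)^2}"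

end

theory Submission
  imports Defs
begin

text \<open>On the sensing circle the field is a trigonometric polynomial of degree two up to a Taylor
  remainder, so the estimation error \<open>e\<close> satisfies \<open>V e = u\<close>, where \<open>u\<close> collects the remainders, the
  ridge bias and the noise. The norm of \<open>u\<close> in \<open>V\<^sup>-\<^sup>1\<close> is at most \<open>c\<close> as soon as
  \<open>u \<bullet> x \<le> c * sqrt (x \<bullet> V x)\<close> for all \<open>x\<close>, and this form of the bound is additive over the four
  contributions.

  The noise of the first sample is treated by a Chernoff bound. For the others, the self-normalised
  quantity \<open>exp (\<parallel>S\<^sub>n\<parallel>\<^sup>2 / (2 \<sigma>\<^sup>2)) * sqrt (det V\<^sub>1 / det V\<^sub>n)\<close>, with the norm of \<open>V\<^sub>n\<^sup>-\<^sup>1\<close>, is a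
  supermartingale: by the rank-one update formulas one step multiplies it by a factor that is a
  one-dimensional Gaussian mixture of \<open>exp (x w - x\<^sup>2 / 2)\<close>, so no multivariate Gaussian integral
  occurs. Ville's inequality on every event of the initial \<open>\<sigma>\<close>-algebra gives the conditional
  statement.\<close>

section \<open>Positive definite matrices and rank-one updates\<close>

text \<open>\<open>Lambda\<close> leaves the intercept unpenalised, so it is singular and cannot be
  the precision of a Gaussian prior. The first sample closes this gap: its regressor is the
  intercept direction, and \<open>Vmat lam a 1\<close> is a fixed positive definite diagonal matrix.
  This matrix acts as the prior. Hence the noise of that sample stays outside the supermartingale
  and gets a bound of its own, and \<open>radius\<close> compares determinants with the one at
  sample 1. The error budget \<delta> is halved between the two: \<open>4 / \<delta>\<close> is the
  two-sided Chernoff constant at level \<open>\<delta> / 2\<close>, and \<open>2 / \<delta>\<close>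
  is the threshold of Ville's inequality at the same level. A one-dimensional mixture suffices
  because a new sample sees the coefficient vector only through its product with the new regressor.
  The mixture needs tilts that depend on the past, whereas the noise assumption speaks of fixed
  ones; constant, simple and measurable tilts are therefore treated in turn. The estimates carry an
  arbitrary past event or weight, which makes them conditional statements although only integrals
  over \<open>M\<close> occur.\<close>

definition outer :: "real^'n \<Rightarrow> real^'n \<Rightarrow> real^'n^'n" where
  "outer u v = (\<chi> i j. u $ i * v $ j)"

lemma outer_mult_vec: "outer u v *v x = (v \<bullet> x) *\<^sub>R u"
  by (simp add: outer_def vec_eq_iff matrix_vector_mult_def inner_vec_def sum_distrib_left sum_distrib_right mult_ac)

lemma matrix_mult_outer: "A ** outer u v = outer (A *v u) v"
  by (simp add: outer_def vec_eq_iff matrix_vector_mult_def matrix_matrix_mult_def sum_distrib_left sum_distrib_right mult_ac)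

lemma outer_matrix_mult: "outer u v ** A = outer u (transpose A *v v)"
  by (simp add: outer_def vec_eq_iff matrix_vector_mult_def matrix_matrix_mult_def transpose_def sum_distrib_left sum_distrib_right mult_ac)

lemma matrix_add_rdistrib: "(A + B) ** C = A ** C + B ** C"
  by (simp add: matrix_matrix_mult_def vec_eq_iff distrib_right sum.distrib)

lemma inner_matrix_mult_left: "(A *v x) \<bullet> y = x \<bullet> (transpose A *v y)" for A :: "real^'n^'m"
  by (metis dot_lmul_matrix inner_commute transpose_matrix_vector)

text \<open>Conjugation by an orthogonal map that carries \<open>v\<close> to a multiple of a
  coordinate axis changes neither side. For such a \<open>v\<close> only one column of the identity
  is altered, and Cramer's rule reads off the determinant.\<close>

lemma det_identity_plus_outer:
  fixes u v :: "real^'n"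
  shows "det (mat 1 + outer u v) = 1 + v \<bullet> u"
proof -
  have axis_case: "det (mat 1 + outer u (c *\<^sub>R axis k 1)) = 1 + (c *\<^sub>R axis k 1) \<bullet> u"
    for u :: "real^'n" and c k
  proof -
    have "mat 1 + outer u (c *\<^sub>R axis k 1) =
        (\<chi> i j. if j = k then (mat 1 *v (axis k 1 + c *\<^sub>R u)) $ i else mat 1 $ i $ j)"
      unfolding matrix_vector_mul_lid by (auto simp: vec_eq_iff outer_def mat_def axis_def)
    then have "det (mat 1 + outer u (c *\<^sub>R axis k 1)) = (axis k 1 + c *\<^sub>R u) $ k * det (mat 1 :: real^'n^'n)"
      by (simp only: cramer_lemma)
    then show ?thesis
      by (simp add: inner_axis' axis_nth)
  qed
  fix k :: 'n
  have "norm v = norm (norm v *\<^sub>R axis k (1::real))"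
    by simp
  then obtain f :: "real^'n \<Rightarrow> real^'n" where f: "orthogonal_transformation f" "f v = norm v *\<^sub>R axis k 1"
    using orthogonal_transformation_exists by metis
  define Q where "Q = matrix f"
  have lf: "linear f" using f(1) by (simp add: orthogonal_transformation_def)
  have Q: "Q *v x = f x" for x
    unfolding Q_def by (simp add: lf matrix_works)
  have oQ: "orthogonal_matrix Q"
    using f(1) orthogonal_transformation_matrix unfolding Q_def by blast
  then have QQ: "Q ** transpose Q = mat 1"
    by (simp add: orthogonal_matrix_def)
  have "Q ** (mat 1 + outer u v) ** transpose Q = mat 1 + outer (f u) (f v)"
    by (simp add: matrix_add_ldistrib matrix_add_rdistrib QQ matrix_mult_outer outer_matrix_mult Q)
  then have "det (Q ** (mat 1 + outer u v) ** transpose Q) = 1 + f v \<bullet> f u"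
    using axis_case[of "f u" "norm v" k] f(2) by simp
  then have "det Q * det (mat 1 + outer u v) * det Q = 1 + f v \<bullet> f u"
    by (simp only: det_mul det_transpose)
  moreover have "det Q * det Q = 1"
    using QQ by (metis det_I det_mul det_transpose)
  moreover have "f v \<bullet> f u = v \<bullet> u"
    using f(1) by (simp add: orthogonal_transformation_def)
  ultimately show ?thesis
    by (metis mult.assoc mult.commute mult.left_neutral)
qed

lemma
  fixes A :: "real^'n^'n"
  assumes "invertible A"
  shows matrix_inv_right: "A ** matrix_inv A = mat 1"
    and matrix_inv_left: "matrix_inv A ** A = mat 1"
proof -
  have "\<exists>B. A ** B = mat 1 \<and> B ** A = mat 1"
    using assms by (simp add: invertible_def)
  from someI_ex[OF this] show "A ** matrix_inv A = mat 1" "matrix_inv A ** A = mat 1"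
    by (simp_all add: matrix_inv_def)
qed

lemma
  fixes A :: "real^'n^'n"
  assumes "invertible A"
  shows mult_matrix_inv_vec: "A *v (matrix_inv A *v x) = x"
    and matrix_inv_mult_vec: "matrix_inv A *v (A *v x) = x"
  using assms by (simp_all add: matrix_vector_mul_assoc matrix_inv_right matrix_inv_left)

text \<open>Matrix determinant lemma, by factoring out \<open>A\<close>; it turns the growth of
  \<open>det (Vmat lam a n)\<close> into a product over the samples.\<close>

lemma det_plus_outer:
  assumes "invertible A"
  shows "det (A + outer u v) = det A * (1 + v \<bullet> (matrix_inv A *v u))"
proof -
  have "A + outer u v = A ** (mat 1 + outer (matrix_inv A *v u) v)"
    by (simp add: matrix_add_ldistrib matrix_mult_outer mult_matrix_inv_vec assms)
  then show ?thesis
    by (simp only: det_mul det_identity_plus_outer)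
qed

text \<open>Symmetry is part of the notion because over the reals it does not follow from positivity
  of the quadratic form, and both Cauchy--Schwarz and the projection bound below rely on it.\<close>

definition posdef :: "real^'n^'n \<Rightarrow> bool" where
  "posdef A \<longleftrightarrow> transpose A = A \<and> (\<forall>x. x \<noteq> 0 \<longrightarrow> 0 < x \<bullet> (A *v x))"

lemma posdef_nonneg: "posdef A \<Longrightarrow> 0 \<le> x \<bullet> (A *v x)"
  by (cases "x = 0") (auto simp: posdef_def less_imp_le)

lemma posdef_inner_commute: "posdef A \<Longrightarrow> (A *v x) \<bullet> y = x \<bullet> (A *v y)"
  by (simp add: inner_matrix_mult_left posdef_def)

lemma posdef_invertible:
  assumes "posdef A"
  shows "invertible A"
proof -
  have "x = 0" if "A *v x = 0" for x
    using assms that unfolding posdef_def by (metis inner_zero_right less_irrefl)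
  then show ?thesis
    by (simp add: invertible_left_inverse matrix_left_invertible_ker)
qed

lemma posdef_matrix_inv:
  assumes "posdef A"
  shows "posdef (matrix_inv A)"
  unfolding posdef_def
proof (intro conjI allI impI)
  note inv = posdef_invertible[OF assms]
  have "A ** transpose (matrix_inv A) = mat 1"
    using matrix_inv_left[OF inv] assms
    by (metis matrix_transpose_mul posdef_def transpose_mat)
  then show "transpose (matrix_inv A) = matrix_inv A"
    by (metis inv matrix_inv_left matrix_mul_assoc matrix_mul_lid matrix_mul_rid)
  fix x :: "real^'a" assume "x \<noteq> 0"
  then have "matrix_inv A *v x \<noteq> 0"
    by (metis inv matrix_vector_mult_0_right mult_matrix_inv_vec)
  then have "0 < (matrix_inv A *v x) \<bullet> (A *v (matrix_inv A *v x))"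
    using assms by (simp add: posdef_def)
  then show "0 < x \<bullet> (matrix_inv A *v x)"
    by (simp add: mult_matrix_inv_vec inv inner_commute)
qed

lemma posdef_plus_outer:
  assumes "posdef A"
  shows "posdef (A + outer u u)"
proof -
  have "transpose (A + outer u u) = A + outer u u"
    using assms by (auto simp: posdef_def transpose_def outer_def vec_eq_iff)
  moreover have "x \<bullet> ((A + outer u u) *v x) = x \<bullet> (A *v x) + (u \<bullet> x)\<^sup>2" for x
    by (simp add: matrix_vector_mult_add_rdistrib outer_mult_vec inner_right_distrib
        inner_commute power2_eq_square)
  ultimately show ?thesis
    using assms by (simp add: posdef_def add_pos_nonneg)
qed

lemma posdef_Cauchy_Schwarz:
  assumes "posdef A"
  shows "x \<bullet> (A *v y) \<le> sqrt (x \<bullet> (A *v x)) * sqrt (y \<bullet> (A *v y))"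
proof (cases "y = 0")
  case False
  define c where "c = y \<bullet> (A *v y)"
  define b where "b = x \<bullet> (A *v y)"
  have c: "0 < c" using assms False by (simp add: posdef_def c_def)
  have yx: "y \<bullet> (A *v x) = b"
    using posdef_inner_commute[OF assms, of y x] by (simp add: b_def inner_commute)
  \<comment> \<open>\<open>z\<close> is \<open>x\<close> minus its projection onto \<open>y\<close>
    in the inner product of \<open>A\<close>; nonnegativity of its quadratic form is the squared
    inequality.\<close>
  define z where "z = x - (b / c) *\<^sub>R y"
  have "0 \<le> z \<bullet> (A *v z)"
    by (rule posdef_nonneg[OF assms])
  also have "z \<bullet> (A *v z) = x \<bullet> (A *v x) - (b / c) * b - (b / c) * b + (b / c) * (b / c) * c"
    unfolding z_def
    by (simp add: matrix_vector_mult_diff_distrib matrix_vector_mult_scaleR inner_diff_left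
        inner_diff_right yx flip: b_def c_def)
  also have "\<dots> = x \<bullet> (A *v x) - b\<^sup>2 / c"
    using c by (simp add: field_simps power2_eq_square)
  finally have "b\<^sup>2 \<le> (x \<bullet> (A *v x)) * c"
    using c by (simp add: field_simps)
  then show ?thesis
    unfolding b_def[symmetric] c_def[symmetric] real_sqrt_mult[symmetric]
    by (rule real_le_rsqrt)
qed simp

text \<open>The supermartingale controls the noise in the inverse norm. This direction of the
  duality brings that control into the tested form in which the four contributions are added; with
  \<open>s = A *v y\<close> it is Cauchy--Schwarz for \<open>A\<close>.\<close>

lemma inner_le_of_matrix_inv_norm_le:
  assumes "posdef A" and "s \<bullet> (matrix_inv A *v s) \<le> c\<^sup>2" and "0 \<le> c"
  shows "s \<bullet> x \<le> c * sqrt (x \<bullet> (A *v x))"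
proof -
  define y where "y = matrix_inv A *v s"
  have s: "A *v y = s"
    by (simp add: y_def mult_matrix_inv_vec posdef_invertible assms(1))
  have "s \<bullet> x = y \<bullet> (A *v x)"
    using posdef_inner_commute[OF assms(1), of y x] s by simp
  also have "\<dots> \<le> sqrt (y \<bullet> (A *v y)) * sqrt (x \<bullet> (A *v x))"
    by (rule posdef_Cauchy_Schwarz[OF assms(1)])
  also have "sqrt (y \<bullet> (A *v y)) \<le> c"
    using assms(2,3) by (simp add: s inner_commute y_def[symmetric] real_le_lsqrt)
  then have "sqrt (y \<bullet> (A *v y)) * sqrt (x \<bullet> (A *v x)) \<le> c * sqrt (x \<bullet> (A *v x))"
    by (intro mult_right_mono real_sqrt_ge_zero posdef_nonneg assms)
  finally show ?thesis .
qed

text \<open>The Sherman--Morrison formula, evaluated on the quadratic form of the updated inverse.\<close>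

lemma rank_one_update_quadratic:
  fixes u s :: "real^'n" and w :: real
  assumes A: "posdef A"
  defines "a \<equiv> u \<bullet> (matrix_inv A *v u)" and "m \<equiv> u \<bullet> (matrix_inv A *v s)"
  shows "(s + w *\<^sub>R u) \<bullet> (matrix_inv (A + outer u u) *v (s + w *\<^sub>R u))
    = s \<bullet> (matrix_inv A *v s) + (a * w\<^sup>2 + 2 * m * w - m\<^sup>2) / (1 + a)"
proof -
  define B where "B = A + outer u u"
  note invA = posdef_invertible[OF A]
  have B: "posdef B" unfolding B_def by (rule posdef_plus_outer[OF A])
  define x where "x = matrix_inv A *v s"
  define v where "v = matrix_inv A *v u"
  have Ax: "A *v x = s" and Av: "A *v v = u"
    by (simp_all add: x_def v_def mult_matrix_inv_vec invA)
  have a0: "0 \<le> a" unfolding a_def by (rule posdef_nonneg[OF posdef_matrix_inv[OF A]])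
  \<comment> \<open>Ansatz \<open>x + c *\<^sub>R v\<close> for the preimage of
    \<open>s + w *\<^sub>R u\<close> under \<open>B\<close>: as \<open>B\<close> sends
    \<open>x\<close> to \<open>s + m *\<^sub>R u\<close> and \<open>v\<close> to
    \<open>(1 + a) *\<^sub>R u\<close>, the coefficient must satisfy
    \<open>m + c * (1 + a) = w\<close>.\<close>
  define c where "c = (w - m) / (1 + a)"
  have ca: "c * (1 + a) = w - m" using a0 by (simp add: c_def)
  have am: "u \<bullet> v = a" "u \<bullet> x = m" by (simp_all add: a_def m_def x_def v_def)
  have sv: "s \<bullet> v = m"
    using posdef_inner_commute[OF A, of x v] by (simp add: Ax Av am inner_commute)
  have "B *v (x + c *\<^sub>R v) = s + (c + m + c * a) *\<^sub>R u"
    by (simp add: B_def matrix_vector_mult_add_rdistrib matrix_vector_right_distrib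
        matrix_vector_mult_scaleR outer_mult_vec Ax Av am algebra_simps)
  also have "c + m + c * a = w"
    using ca by (simp add: algebra_simps)
  finally have "matrix_inv B *v (s + w *\<^sub>R u) = x + c *\<^sub>R v"
    by (metis B matrix_inv_mult_vec posdef_invertible)
  then have "(s + w *\<^sub>R u) \<bullet> (matrix_inv B *v (s + w *\<^sub>R u)) = s \<bullet> x + (c * m + w * m + w * c * a)"
    by (simp add: inner_left_distrib inner_right_distrib sv am algebra_simps)
  also have "c * m + w * m + w * c * a = (a * w\<^sup>2 + 2 * m * w - m\<^sup>2) / (1 + a)"
  proof -
    have "(c * m + w * m + w * c * a) * (1 + a) = (c * (1 + a)) * (m + w * a) + w * m * (1 + a)"
      by (simp add: algebra_simps)
    also have "\<dots> = a * w\<^sup>2 + 2 * m * w - m\<^sup>2"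
      unfolding ca by (simp add: algebra_simps power2_eq_square)
    finally show ?thesis using a0 by (simp add: eq_divide_eq)
  qed
  finally show ?thesis by (simp add: B_def x_def)
qed

lemma posdef_congruence:
  fixes G :: "real^'n^'m"
  assumes A: "posdef A" and inj: "\<And>x. transpose G *v x = 0 \<Longrightarrow> x = 0"
  shows "posdef (G ** A ** transpose G)"
  unfolding posdef_def
proof (intro conjI allI impI)
  show "transpose (G ** A ** transpose G) = G ** A ** transpose G"
    using A by (simp add: matrix_transpose_mul posdef_def matrix_mul_assoc)
  fix x :: "real^'m" assume "x \<noteq> 0"
  then have "0 < (transpose G *v x) \<bullet> (A *v (transpose G *v x))"
    using A inj unfolding posdef_def by blast
  also have "\<dots> = x \<bullet> (G *v (A *v (transpose G *v x)))"
    by (simp only: inner_matrix_mult_left transpose_transpose)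
  also have "\<dots> = x \<bullet> ((G ** A ** transpose G) *v x)"
    by (simp only: matrix_vector_mul_assoc matrix_mul_assoc)
  finally show "0 < x \<bullet> ((G ** A ** transpose G) *v x)" .
qed

text \<open>Among the vectors with the same image under \<open>G\<close> as \<open>e\<close>, the
  vector \<open>q\<close> has the least quadratic form, and that minimum is the left-hand side.
  Since \<open>e - q\<close> is orthogonal to \<open>q\<close> with respect to \<open>A\<close>, the
  claim is Pythagoras. It passes from the five coefficients to the two gradient components.\<close>

lemma projected_norm_le:
  fixes G :: "real^'n^'m" and A :: "real^'n^'n"
  assumes A: "posdef A" and P: "posdef (G ** matrix_inv A ** transpose G)"
  shows "(G *v e) \<bullet> (matrix_inv (G ** matrix_inv A ** transpose G) *v (G *v e)) \<le> e \<bullet> (A *v e)"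
proof -
  define P where "P = G ** matrix_inv A ** transpose G"
  define x where "x = matrix_inv P *v (G *v e)"
  define q where "q = matrix_inv A *v (transpose G *v x)"
  note invA = posdef_invertible[OF A]
  have Px: "P *v x = G *v e"
    using P by (simp add: x_def P_def mult_matrix_inv_vec posdef_invertible)
  have Aq: "A *v q = transpose G *v x"
    by (simp add: q_def mult_matrix_inv_vec invA)
  have eGx: "(G *v e) \<bullet> x = e \<bullet> (A *v q)"
    by (simp add: Aq inner_matrix_mult_left)
  have "P *v x = G *v q"
    unfolding P_def q_def by (simp only: matrix_vector_mul_assoc matrix_mul_assoc)
  then have "e \<bullet> (A *v q) = (G *v q) \<bullet> x"
    using eGx Px by simp
  also have "\<dots> = q \<bullet> (A *v q)"
    by (simp only: Aq inner_matrix_mult_left)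
  finally have eq: "e \<bullet> (A *v q) = q \<bullet> (A *v q)" .
  have "0 \<le> (e - q) \<bullet> (A *v (e - q))"
    by (rule posdef_nonneg[OF A])
  also have "\<dots> = e \<bullet> (A *v e) - e \<bullet> (A *v q)"
    using eq posdef_inner_commute[OF A, of q e]
    by (simp add: matrix_vector_mult_diff_distrib inner_diff_left inner_diff_right inner_commute)
  finally show ?thesis
    using eGx by (simp add: x_def P_def)
qed

section \<open>Measurability of determinants and inverses\<close>

lemma borel_measurable_det:
  fixes A :: "'a \<Rightarrow> real^'n^'n"
  assumes "\<And>i j. (\<lambda>\<omega>. A \<omega> $ i $ j) \<in> borel_measurable M"
  shows "(\<lambda>\<omega>. det (A \<omega>)) \<in> borel_measurable M"
  unfolding det_def by (intro borel_measurable_sum borel_measurable_times borel_measurable_const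
      borel_measurable_prod assms)

text \<open>\<open>matrix_inv\<close> is defined by a choice, so its entries come with no formula;
  Cramer's rule writes them as quotients of determinants.\<close>

lemma borel_measurable_matrix_inv:
  fixes A :: "'a \<Rightarrow> real^'n^'n"
  assumes inv: "\<And>\<omega>. \<omega> \<in> space M \<Longrightarrow> invertible (A \<omega>)"
    and meas: "\<And>i j. (\<lambda>\<omega>. A \<omega> $ i $ j) \<in> borel_measurable M"
  shows "(\<lambda>\<omega>. matrix_inv (A \<omega>) $ i $ j) \<in> borel_measurable M"
proof -
  define C where "C \<omega> = (\<chi> r c. if c = i then axis j 1 $ r else A \<omega> $ r $ c)" for \<omega>
  have "matrix_inv (A \<omega>) $ i $ j = det (C \<omega>) / det (A \<omega>)" if "\<omega> \<in> space M" for \<omega>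
  proof -
    have "det (A \<omega>) \<noteq> 0"
      using inv[OF that] by (simp add: invertible_det_nz)
    from cramer[OF this, of "matrix_inv (A \<omega>) *v axis j 1" "axis j 1"]
    have "matrix_inv (A \<omega>) *v axis j 1 = (\<chi> k. det (\<chi> r c. if c = k then axis j 1 $ r else A \<omega> $ r $ c) / det (A \<omega>))"
      using mult_matrix_inv_vec[OF inv[OF that]] by simp
    then have "(matrix_inv (A \<omega>) *v axis j 1) $ i = det (C \<omega>) / det (A \<omega>)"
      by (simp add: C_def)
    then show ?thesis
      by (simp add: matrix_vector_mult_basis column_def)
  qed
  moreover have "(\<lambda>\<omega>. C \<omega> $ r $ c) \<in> borel_measurable M" for r c
    by (cases "c = i") (simp_all add: C_def meas)
  then have "(\<lambda>\<omega>. det (C \<omega>)) \<in> borel_measurable M"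
    by (rule borel_measurable_det)
  moreover have "(\<lambda>\<omega>. det (A \<omega>)) \<in> borel_measurable M"
    by (rule borel_measurable_det[OF meas])
  ultimately show ?thesis
    by (simp cong: measurable_cong)
qed

section \<open>The field on the sensing circle\<close>

lemma has_derivative_fderiv:
  assumes "f differentiable_on UNIV"
  shows "(f has_derivative blinfun_apply (fderiv f x)) (at x)"
proof -
  have "(f has_derivative frechet_derivative f (at x)) (at x)"
    using assms frechet_derivative_works by (auto simp: differentiable_on_def)
  then show ?thesis
    by (simp add: fderiv_def bounded_linear_Blinfun_apply has_derivative_bounded_linear)
qed

lemma has_vector_derivative_along_line:
  assumes "f differentiable_on UNIV"
  shows "((\<lambda>t. f (x + t *\<^sub>R h)) has_vector_derivative fderiv f (x + t *\<^sub>R h) h) (at t)"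
proof -
  have "((\<lambda>t. x + t *\<^sub>R h) has_derivative (\<lambda>s. s *\<^sub>R h)) (at t)"
    by (auto intro!: derivative_eq_intros)
  from has_derivative_compose[OF this has_derivative_fderiv[OF assms]]
  show ?thesis
    by (simp add: has_vector_derivative_def blinfun.scaleR_right)
qed

lemma has_vector_derivative_blinfun_apply_const:
  "(f has_vector_derivative D) F \<Longrightarrow> ((\<lambda>t. blinfun_apply (f t) h) has_vector_derivative blinfun_apply D h) F"
  by (rule bounded_linear.has_vector_derivative[OF bounded_bilinear.bounded_linear_left[OF bounded_bilinear_blinfun_apply]])

text \<open>Taylor's theorem with Lagrange remainder for \<open>F (x + t *\<^sub>R h)\<close> as a
  function of \<open>t\<close> on the unit interval. Its third derivative is the trilinear form
  applied to \<open>h\<close> three times, whence \<open>norm h ^ 3\<close>, and 6 is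
  \<open>fact 3\<close>.\<close>

lemma C3_field_taylor:
  assumes "C3_field F" and M3: "\<And>x. norm (fderiv (fderiv (fderiv F)) x) \<le> M3"
  shows "\<bar>F (x + h) - (F x + fderiv F x h + fderiv (fderiv F) x h h / 2)\<bar> \<le> M3 * norm h ^ 3 / 6"
proof -
  have d: "F differentiable_on UNIV" "fderiv F differentiable_on UNIV" "fderiv (fderiv F) differentiable_on UNIV"
    using assms(1) by (auto simp: C3_field_def)
  define diff where "diff m t = (if m = 0 then F (x + t *\<^sub>R h)
    else if m = 1 then fderiv F (x + t *\<^sub>R h) h
    else if m = 2 then fderiv (fderiv F) (x + t *\<^sub>R h) h h
    else fderiv (fderiv (fderiv F)) (x + t *\<^sub>R h) h h h)" for m :: nat and t
  have "(diff m has_real_derivative diff (Suc m) t) (at t)" if "m < 3" for m t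
  proof -
    have "m = 0 \<or> m = 1 \<or> m = 2" using that by auto
    then show ?thesis
      unfolding has_real_derivative_iff_has_vector_derivative diff_def
      using has_vector_derivative_along_line[OF d(1)]
        has_vector_derivative_blinfun_apply_const[OF has_vector_derivative_along_line[OF d(2)]]
        has_vector_derivative_blinfun_apply_const[OF
          has_vector_derivative_blinfun_apply_const[OF has_vector_derivative_along_line[OF d(3)]]]
      by auto
  qed
  then obtain t where t: "diff 0 1 = (\<Sum>m<3. diff m 0 / fact m * 1 ^ m) + diff 3 t / fact 3 * 1 ^ 3"
    using Maclaurin[of 1 3 diff "diff 0"] by auto
  have d3: "\<bar>diff 3 t\<bar> \<le> M3 * norm h ^ 3"
  proof -
    let ?T = "fderiv (fderiv (fderiv F)) (x + t *\<^sub>R h)"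
    have "\<bar>diff 3 t\<bar> = norm (?T h h h)" by (simp add: diff_def)
    also have "\<dots> \<le> norm (?T h h) * norm h" by (rule norm_blinfun)
    also have "\<dots> \<le> norm (?T h) * norm h * norm h" by (intro mult_right_mono norm_blinfun) simp
    also have "\<dots> \<le> norm ?T * norm h * norm h * norm h" by (intro mult_right_mono norm_blinfun) simp_all
    also have "\<dots> \<le> M3 * norm h * norm h * norm h" by (intro mult_right_mono M3) simp_all
    finally show ?thesis by (simp add: power3_eq_cube mult_ac)
  qed
  have eq: "F (x + h) - (F x + fderiv F x h + fderiv (fderiv F) x h h / 2) = diff 3 t / 6"
    using t by (simp add: diff_def eval_nat_numeral)
  show ?thesis
    unfolding eq using d3 by (simp add: abs_divide)
qed

lemma fderiv_eq_grad:
  assumes "F differentiable_on UNIV"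
  shows "fderiv F x v = grad F x \<bullet> v"
proof -
  have "F differentiable (at x)" using assms by (auto simp: differentiable_on_def)
  then have "(F has_derivative frechet_derivative F (at x)) (at x)"
    by (simp add: frechet_derivative_works)
  then have eq: "blinfun_apply (fderiv F x) = frechet_derivative F (at x)"
    by (simp add: fderiv_def bounded_linear_Blinfun_apply has_derivative_bounded_linear)
  have "fderiv F x v = fderiv F x (\<Sum>i\<in>UNIV. v $ i *\<^sub>R axis i 1)"
    using basis_expansion[of v] by (simp add: scalar_mult_eq_scaleR)
  also have "\<dots> = grad F x \<bullet> v"
    by (simp only: blinfun.sum_right blinfun.scaleR_right) (simp add: eq grad_def inner_vec_def mult_ac)
  finally show ?thesis .
qed

text \<open>Difference quotients of \<open>grad F\<close> inherit the Lipschitz bound, and the bound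
  passes to the limit. The slot of \<open>u\<close> is the direction of differentiation, that of
  \<open>v\<close> belongs to the gradient.\<close>

lemma hessian_bound:
  assumes "C3_field F" and L: "\<And>x x'. norm (grad F x - grad F x') \<le> L * norm (x - x')"
  shows "\<bar>fderiv (fderiv F) x u v\<bar> \<le> L * norm u * norm v"
proof -
  have d: "F differentiable_on UNIV" "fderiv F differentiable_on UNIV"
    using assms(1) by (auto simp: C3_field_def)
  let ?f = "\<lambda>t. fderiv F (x + t *\<^sub>R u) v"
  have "(?f has_real_derivative fderiv (fderiv F) (x + 0 *\<^sub>R u) u v) (at 0)"
    unfolding has_real_derivative_iff_has_vector_derivative
    by (rule has_vector_derivative_blinfun_apply_const[OF has_vector_derivative_along_line[OF d(2)]])
  then have "(\<lambda>t. (?f t - ?f 0) / t) \<midarrow>0\<rightarrow> fderiv (fderiv F) x u v"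
    by (simp add: has_field_derivative_iff)
  from tendsto_rabs[OF this] show ?thesis
  proof (rule tendsto_upperbound)
    have "\<bar>(?f t - ?f 0) / t\<bar> \<le> L * norm u * norm v" if "t \<noteq> 0" for t
    proof -
      have "\<bar>?f t - ?f 0\<bar> = \<bar>(grad F (x + t *\<^sub>R u) - grad F x) \<bullet> v\<bar>"
        by (simp add: fderiv_eq_grad d inner_diff_left)
      also have "\<dots> \<le> norm (grad F (x + t *\<^sub>R u) - grad F x) * norm v"
        by (rule Cauchy_Schwarz_ineq2)
      also have "\<dots> \<le> L * norm (x + t *\<^sub>R u - x) * norm v"
        by (intro mult_right_mono L) simp
      finally show ?thesis using that by (simp add: field_simps)
    qed
    then show "\<forall>\<^sub>F t in at 0. \<bar>(?f t - ?f 0) / t\<bar> \<le> L * norm u * norm v"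
      by (auto simp: eventually_at_filter)
  qed simp
qed

lemma exhaust_5:
  fixes x :: 5
  shows "x = 1 \<or> x = 2 \<or> x = 3 \<or> x = 4 \<or> x = 5"
proof (induct x)
  case (of_int z)
  then have "z = 0 \<or> z = 1 \<or> z = 2 \<or> z = 3 \<or> z = 4" by fastforce
  then show ?case by auto
qed

lemma forall_5: "(\<forall>i::5. P i) \<longleftrightarrow> P 1 \<and> P 2 \<and> P 3 \<and> P 4 \<and> P 5"
  by (metis exhaust_5)

lemma UNIV_5: "UNIV = {1, 2, 3, 4, 5::5}"
  using exhaust_5 by auto

lemma sum_5: "sum f (UNIV::5 set) = f 1 + f 2 + f 3 + f 4 + f 5"
  unfolding UNIV_5 by (simp add: ac_simps)

lemma vector_5:
  "(vector [a, b, c, d, e] :: 'a::zero^5) $ 1 = a"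
  "(vector [a, b, c, d, e] :: 'a::zero^5) $ 2 = b"
  "(vector [a, b, c, d, e] :: 'a::zero^5) $ 3 = c"
  "(vector [a, b, c, d, e] :: 'a::zero^5) $ 4 = d"
  "(vector [a, b, c, d, e] :: 'a::zero^5) $ 5 = e"
  unfolding vector_def by simp_all

lemma vector_4:
  "(vector [a, b, c, d] :: 'a::zero^4) $ 1 = a"
  "(vector [a, b, c, d] :: 'a::zero^4) $ 2 = b"
  "(vector [a, b, c, d] :: 'a::zero^4) $ 3 = c"
  "(vector [a, b, c, d] :: 'a::zero^4) $ 4 = d"
  unfolding vector_def by simp_all

text \<open>In the orthonormal frame \<open>e\<close>, \<open>f\<close> of the robot the linear
  Taylor term is the first harmonic, with coefficients \<rho> times the local gradient. The double
  angle formulas split the quadratic term into its mean, which goes into \<open>c\<close>, and a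
  second harmonic whose coefficients are \<open>\<rho>\<^sup>2 / 2\<close> times those of the
  traceless part of the Hessian. That part has amplitude at most \<open>L\<close>, which yields the
  summand \<open>\<rho>^4 * L^2 / 4\<close> of \<open>S_xi\<close>.\<close>

lemma circle_expansion:
  fixes p :: "real^2" and \<theta> :: real
  assumes field: "field_assumption F p0 pstar G L M3 \<Delta>0" and "0 < \<rho>"
  defines "g \<equiv> local_grad F p \<theta>"
  obtains h3 h4 c where
    "norm (vector [\<rho> * g $ 1, \<rho> * g $ 2, h3, h4] :: real^4) \<le> S_xi \<rho> G L"
    "\<forall>\<alpha>. \<bar>F (p + \<rho> *\<^sub>R phi (\<theta> + \<alpha>)) - (c + vector [\<rho> * g $ 1, \<rho> * g $ 2, h3, h4] \<bullet> zvec \<alpha>)\<bar> \<le> bias_bound \<rho> M3"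
proof -
  have C3: "C3_field F" and L0: "0 < L"
    and gG: "norm (grad F p) \<le> G"
    and L: "\<And>x x'. norm (grad F x - grad F x') \<le> L * norm (x - x')"
    and M3: "\<And>x. norm (fderiv (fderiv (fderiv F)) x) \<le> M3"
    using field by (auto simp: field_assumption_def)
  have d: "F differentiable_on UNIV" using C3 by (simp add: C3_field_def)
  define e f where "e = phi \<theta>" and "f = phi (\<theta> + pi / 2)"
  have f: "f = vector [- sin \<theta>, cos \<theta>]" and e: "e = vector [cos \<theta>, sin \<theta>]"
    by (simp_all add: f_def e_def phi_def cos_add sin_add)
  have on: "e \<bullet> e = 1" "f \<bullet> f = 1" "e \<bullet> f = 0" "f \<bullet> e = 0"
    by (simp_all add: e f inner_vec_def sum_2 flip: power2_eq_square)
  have ph: "phi (\<theta> + \<alpha>) = cos \<alpha> *\<^sub>R e + sin \<alpha> *\<^sub>R f" for \<alpha>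
    by (simp add: vec_eq_iff forall_2 e f phi_def cos_add sin_add algebra_simps)
  have g: "g $ 1 = grad F p \<bullet> e" "g $ 2 = grad F p \<bullet> f"
    by (simp_all add: g_def local_grad_def e f rotation_def transpose_def matrix_vector_mult_def
        inner_vec_def sum_2 mult_ac)
  have gsq: "(g $ 1)\<^sup>2 + (g $ 2)\<^sup>2 \<le> G\<^sup>2"
  proof -
    have "(g $ 1)\<^sup>2 + (g $ 2)\<^sup>2 = ((grad F p $ 1)\<^sup>2 + (grad F p $ 2)\<^sup>2) * ((sin \<theta>)\<^sup>2 + (cos \<theta>)\<^sup>2)"
      unfolding g by (simp only: e f inner_vec_def sum_2 vector_2 inner_real_def) algebra
    also have "\<dots> = (norm (grad F p))\<^sup>2"
      by (simp add: power2_norm_eq_inner inner_vec_def sum_2 flip: power2_eq_square)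
    also have "\<dots> \<le> G\<^sup>2" using gG by (intro power_mono) auto
    finally show ?thesis .
  qed
  define B where "B u v = fderiv (fderiv F) p u v" for u v
  have Bb: "\<bar>B u v\<bar> \<le> L * norm u * norm v" for u v
    unfolding B_def by (rule hessian_bound[OF C3 L])
  have Blin: "B (r *\<^sub>R u + s *\<^sub>R v) x = r * B u x + s * B v x"
    "B x (r *\<^sub>R u + s *\<^sub>R v) = r * B x u + s * B x v" for r s u v x
    by (simp_all add: B_def blinfun.add_left blinfun.add_right blinfun.scaleR_left blinfun.scaleR_right)
  define k2 s2 where "k2 = (B e e - B f f) / 2" and "s2 = (B e f + B f e) / 2"
  \<comment> \<open>Testing \<open>B\<close> against the vector \<open>(k2, s2)\<close> and its rotation gives \<open>A\<^sup>2 \<le> L * A\<close> without assuming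
    that \<open>B\<close> is symmetric.\<close>
  have amp: "k2\<^sup>2 + s2\<^sup>2 \<le> L\<^sup>2"
  proof -
    define A where "A = sqrt (k2\<^sup>2 + s2\<^sup>2)"
    have A: "A\<^sup>2 = k2\<^sup>2 + s2\<^sup>2" "0 \<le> A" by (simp_all add: A_def)
    have n1: "norm (k2 *\<^sub>R e + s2 *\<^sub>R f) = A" "norm (s2 *\<^sub>R e + (- k2) *\<^sub>R f) = A"
      by (simp_all add: A_def norm_eq_sqrt_inner inner_left_distrib inner_right_distrib inner_diff_left
          inner_diff_right on power2_eq_square add.commute)
    have n2: "norm e = 1" "norm f = 1" by (simp_all add: norm_eq_sqrt_inner on)
    have "2 * A\<^sup>2 = B e (k2 *\<^sub>R e + s2 *\<^sub>R f) + B f (s2 *\<^sub>R e + (- k2) *\<^sub>R f)"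
      unfolding Blin A by (simp add: k2_def s2_def power2_eq_square field_simps)
    also have "\<dots> \<le> L * A + L * A"
      using Bb[of e "k2 *\<^sub>R e + s2 *\<^sub>R f"] Bb[of f "s2 *\<^sub>R e + (- k2) *\<^sub>R f"]
      unfolding n1 n2 by linarith
    finally have "A\<^sup>2 \<le> L * A" by linarith
    then have "A \<le> L" using A(2) L0 by (cases "A = 0") (auto simp: power2_eq_square)
    then have "A\<^sup>2 \<le> L\<^sup>2" using A(2) by (rule power_mono)
    then show ?thesis by (simp add: A)
  qed
  define h3 h4 c where "h3 = \<rho>\<^sup>2 / 2 * k2" and "h4 = \<rho>\<^sup>2 / 2 * s2" and "c = F p + \<rho>\<^sup>2 / 4 * (B e e + B f f)"
  let ?\<eta> = "vector [\<rho> * g $ 1, \<rho> * g $ 2, h3, h4] :: real^4"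
  show thesis
  proof (rule that[of h3 h4 c], goal_cases)
    case 1
    have "?\<eta> \<bullet> ?\<eta> = \<rho>\<^sup>2 * ((g $ 1)\<^sup>2 + (g $ 2)\<^sup>2) + \<rho>^4 / 4 * (k2\<^sup>2 + s2\<^sup>2)"
      by (simp add: inner_vec_def sum_4 vector_4 h3_def h4_def power2_eq_square power4_eq_xxxx field_simps)
    also have "\<dots> \<le> \<rho>\<^sup>2 * G\<^sup>2 + \<rho>^4 / 4 * L\<^sup>2"
      by (intro add_mono mult_left_mono gsq amp) simp_all
    finally show ?case
      by (simp add: S_xi_def norm_eq_sqrt_inner)
  next
    case 2
    show ?case
    proof
      fix \<alpha>
      have n: "norm (\<rho> *\<^sub>R phi (\<theta> + \<alpha>)) = \<rho>"
      proof -
        have "norm (phi x) = 1" for x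
          by (simp add: norm_eq_sqrt_inner phi_def inner_vec_def sum_2 flip: power2_eq_square)
        then show ?thesis using \<open>0 < \<rho>\<close> by simp
      qed
      have lin: "fderiv F p (\<rho> *\<^sub>R phi (\<theta> + \<alpha>)) = \<rho> * g $ 1 * cos \<alpha> + \<rho> * g $ 2 * sin \<alpha>"
        unfolding fderiv_eq_grad[OF d] ph g by (simp add: inner_right_distrib algebra_simps)
      have quad: "fderiv (fderiv F) p (\<rho> *\<^sub>R phi (\<theta> + \<alpha>)) (\<rho> *\<^sub>R phi (\<theta> + \<alpha>)) / 2
        = \<rho>\<^sup>2 / 4 * (B e e + B f f) + h3 * cos (2 * \<alpha>) + h4 * sin (2 * \<alpha>)"
      proof -
        define C s where "C = cos \<alpha>" and "s = sin \<alpha>"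
        have ph': "phi (\<theta> + \<alpha>) = C *\<^sub>R e + s *\<^sub>R f"
          by (simp add: ph C_def s_def)
        have double: "cos (2 * \<alpha>) = C * C - s * s" "sin (2 * \<alpha>) = 2 * s * C" and one: "C * C + s * s = 1"
          by (simp_all add: C_def s_def cos_double sin_double power2_eq_square)
        have expr: "fderiv (fderiv F) p (\<rho> *\<^sub>R phi (\<theta> + \<alpha>)) (\<rho> *\<^sub>R phi (\<theta> + \<alpha>))
          = \<rho>\<^sup>2 * (C * (C * B e e + s * B e f) + s * (C * B f e + s * B f f))"
          by (simp only: ph' blinfun.scaleR_left blinfun.scaleR_right flip: B_def) (simp add: Blin power2_eq_square algebra_simps)
        \<comment> \<open>The factor \<open>C * C + s * s\<close>, which equals 1, makes both sides
          homogeneous of degree two in \<open>C\<close> and \<open>s\<close>, so that this is a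
          polynomial identity.\<close>
        have "\<rho>\<^sup>2 * (C * (C * B e e + s * B e f) + s * (C * B f e + s * B f f)) / 2
          = \<rho>\<^sup>2 / 4 * (B e e + B f f) * (C * C + s * s) + h3 * (C * C - s * s) + h4 * (2 * s * C)"
          by (simp add: h3_def h4_def k2_def s2_def field_simps)
        then show ?thesis
          by (simp only: expr double one mult_1_right)
      qed
      have "c + ?\<eta> \<bullet> zvec \<alpha> = F p + fderiv F p (\<rho> *\<^sub>R phi (\<theta> + \<alpha>))
        + fderiv (fderiv F) p (\<rho> *\<^sub>R phi (\<theta> + \<alpha>)) (\<rho> *\<^sub>R phi (\<theta> + \<alpha>)) / 2"
        unfolding lin quad by (simp add: c_def zvec_def inner_vec_def sum_4 vector_4)
      with C3_field_taylor[OF C3 M3, of p "\<rho> *\<^sub>R phi (\<theta> + \<alpha>)"]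
      show "\<bar>F (p + \<rho> *\<^sub>R phi (\<theta> + \<alpha>)) - (c + ?\<eta> \<bullet> zvec \<alpha>)\<bar> \<le> bias_bound \<rho> M3"
        by (simp only: n bias_bound_def)
    qed
  qed
qed

section \<open>The regularised least-squares estimator\<close>

lemma psi_1: "psi a 1 = axis 1 1"
  by (simp add: psi_def vec_eq_iff forall_5 vector_5 axis_def)

lemma Vmat_Suc: "Vmat lam a (Suc n) = Vmat lam a n + outer (psi a (Suc n)) (psi a (Suc n))"
  by (simp add: Vmat_def outer_def)

text \<open>The regressor of the first sample fills exactly the direction that the ridge term leaves
  out, so this matrix does not depend on the bearings.\<close>

lemma Vmat_1: "Vmat lam a 1 = (\<chi> i j. if i = j then if i = 1 then 1 else lam else 0)"
  using psi_1[of a] by (simp add: Vmat_def Lambda_def vec_eq_iff axis_def)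

lemma posdef_Vmat_1:
  assumes "0 < lam"
  shows "posdef (Vmat lam a 1)"
proof -
  have "0 < x \<bullet> (Vmat lam a 1 *v x)" if nz: "x \<noteq> 0" for x
  proof -
    have "x \<bullet> (Vmat lam a 1 *v x) = (\<Sum>i\<in>UNIV. (if i = 1 then 1 else lam) * (x $ i)\<^sup>2)"
      unfolding Vmat_1 by (simp add: inner_vec_def matrix_vector_mult_def
        mult_delta_left mult_delta_right power2_eq_square mult_ac)
    also have "\<dots> > 0"
    proof -
      obtain i where "x $ i \<noteq> 0" using nz by (auto simp: vec_eq_iff)
      then show ?thesis
        using assms by (intro sum_pos2[of _ i]) auto
    qed
    finally show ?thesis .
  qed
  moreover have "transpose (Vmat lam a 1) = Vmat lam a 1"
    unfolding Vmat_1 by (auto simp: transpose_def vec_eq_iff)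
  ultimately show ?thesis by (simp add: posdef_def)
qed

lemma posdef_Vmat:
  assumes "0 < lam" and "1 \<le> n"
  shows "posdef (Vmat lam a n)"
  using assms(2)
proof (induction n rule: dec_induct)
  case base
  show ?case by (rule posdef_Vmat_1[OF assms(1)])
next
  case (step n)
  then show ?case by (simp add: Vmat_Suc posdef_plus_outer)
qed

lemma Vmat_mult_vec: "Vmat lam a n *v x = Lambda lam *v x + (\<Sum>i=1..n. (psi a i \<bullet> x) *\<^sub>R psi a i)"
proof (induction n)
  case 0
  show ?case by (simp add: Vmat_def)
next
  case (Suc n)
  then show ?case by (simp add: Vmat_Suc matrix_vector_mult_add_rdistrib outer_mult_vec)
qed

lemma inner_Lambda:
  "x \<bullet> (Lambda lam *v y) = lam * (x $ 2 * y $ 2 + x $ 3 * y $ 3 + x $ 4 * y $ 4 + x $ 5 * y $ 5)"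
  by (simp add: Lambda_def inner_vec_def matrix_vector_mult_def sum_5 algebra_simps)

lemma inner_Vmat:
  "x \<bullet> (Vmat lam a n *v x)
    = lam * ((x $ 2)\<^sup>2 + (x $ 3)\<^sup>2 + (x $ 4)\<^sup>2 + (x $ 5)\<^sup>2) + (\<Sum>i=1..n. (psi a i \<bullet> x)\<^sup>2)"
  by (simp add: Vmat_mult_vec inner_right_distrib inner_Lambda inner_sum_right power2_eq_square
      inner_commute)

lemma posdef_Pmat:
  assumes "0 < lam" "1 \<le> n" "0 < \<rho>"
  shows "posdef (Pmat \<rho> lam a n)"
  unfolding Pmat_def
proof (rule posdef_congruence[OF posdef_matrix_inv[OF posdef_Vmat[OF assms(1,2)]]])
  fix x assume "transpose (Gmat \<rho>) *v x = 0"
  then have "(transpose (Gmat \<rho>) *v x) $ 2 = 0" "(transpose (Gmat \<rho>) *v x) $ 3 = 0" by simp_all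
  then show "x = 0"
    using assms(3) by (simp add: Gmat_def transpose_def matrix_vector_mult_def sum_2 vector_5 vec_eq_iff forall_2)
qed

text \<open>The deterministic core: outcome by outcome, bounds \<open>c1\<close> on the first noise
  value and \<open>c2\<close> on the remaining noise in the inverse norm put the gradient into the
  confidence set.\<close>

lemma gradient_covered:
  assumes field: "field_assumption F p0 pstar G L M3 \<Delta>0" and "0 < \<rho>" "0 < lam" "1 \<le> n"
    and meas: "\<And>i. 1 \<le> i \<Longrightarrow> y i = F (p + \<rho> *\<^sub>R phi (\<theta> + a i)) + w i"
    and c1: "\<bar>w 1\<bar> \<le> c1" and c2: "0 \<le> c2"
    and s: "s = (\<Sum>i=2..n. w i *\<^sub>R psi a i)" "s \<bullet> (matrix_inv (Vmat lam a n) *v s) \<le> c2\<^sup>2"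
    and radius: "c1 + c2 + sqrt lam * S_xi \<rho> G L + bias_bound \<rho> M3 * sqrt (real n)
      = radius \<rho> lam \<sigma> G L M3 \<delta> a n"
  shows "local_grad F p \<theta> \<in> conf_set \<rho> lam \<sigma> G L M3 \<delta> a y n"
proof -
  define g where "g = local_grad F p \<theta>"
  obtain h3 h4 c where
    S: "norm (vector [\<rho> * g $ 1, \<rho> * g $ 2, h3, h4] :: real^4) \<le> S_xi \<rho> G L" and
    expand: "\<forall>\<alpha>. \<bar>F (p + \<rho> *\<^sub>R phi (\<theta> + \<alpha>)) - (c + vector [\<rho> * g $ 1, \<rho> * g $ 2, h3, h4] \<bullet> zvec \<alpha>)\<bar> \<le> bias_bound \<rho> M3"
    by (rule circle_expansion[OF field \<open>0 < \<rho>\<close>, of p \<theta>, folded g_def])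
  define \<eta> :: "real^4" where "\<eta> = vector [\<rho> * g $ 1, \<rho> * g $ 2, h3, h4]"
  \<comment> \<open>The regressors are differences to the first bearing, so the true intercept is
    the value of the trigonometric polynomial there. With this \<open>t\<close> the product
    \<open>psi a i \<bullet> t\<close> is the polynomial at \<open>a i\<close>, also for
    \<open>i = 1\<close>.\<close>
  define t :: "real^5" where "t = vector [c + \<eta> \<bullet> zvec (a 1), \<eta> $ 1, \<eta> $ 2, \<eta> $ 3, \<eta> $ 4]"
  have model: "psi a i \<bullet> t = c + \<eta> \<bullet> zvec (a i)" for i
    by (cases "i = 1") (simp_all add: psi_def t_def Let_def inner_vec_def sum_4 sum_5 vector_5 algebra_simps)
  define r where "r i = y i - psi a i \<bullet> t - w i" for i
  have r: "\<bar>r i\<bar> \<le> bias_bound \<rho> M3" if "1 \<le> i" for i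
    using expand[rule_format, of "a i"] by (simp add: r_def meas[OF that] model \<eta>_def)
  have b0: "0 \<le> bias_bound \<rho> M3" using r[of 1] by simp
  define V where "V = Vmat lam a n"
  have V: "posdef V" unfolding V_def by (rule posdef_Vmat) fact+
  define e where "e = t - est lam a y n"
  have "V *v est lam a y n = (\<Sum>i=1..n. y i *\<^sub>R psi a i)"
    by (simp add: est_def V_def mult_matrix_inv_vec posdef_invertible[OF V[unfolded V_def]])
  then have "V *v (- e) = (\<Sum>i=1..n. (r i + w i) *\<^sub>R psi a i) - Lambda lam *v t"
    by (simp add: e_def matrix_vector_mult_diff_distrib V_def Vmat_mult_vec r_def
        algebra_simps sum_subtractf sum.distrib)
  also have "(\<Sum>i=1..n. (r i + w i) *\<^sub>R psi a i) = (\<Sum>i=1..n. r i *\<^sub>R psi a i) + (w 1 *\<^sub>R psi a 1 + s)"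
    using \<open>1 \<le> n\<close> by (simp add: scaleR_left_distrib sum.distrib s(1) sum.atLeast_Suc_atMost numeral_2_eq_2)
  finally have Ve: "V *v (- e) = (\<Sum>i=1..n. r i *\<^sub>R psi a i) + w 1 *\<^sub>R psi a 1 + s - Lambda lam *v t"
    by (simp add: algebra_simps)
  have bound: "(V *v (- e)) \<bullet> x \<le> radius \<rho> lam \<sigma> G L M3 \<delta> a n * sqrt (x \<bullet> (V *v x))" for x
  proof -
    define q where "q = sqrt (x \<bullet> (V *v x))"
    define X :: "real^4" where "X = vector [x $ 2, x $ 3, x $ 4, x $ 5]"
    have q2: "q\<^sup>2 = lam * (norm X)\<^sup>2 + (\<Sum>i=1..n. (psi a i \<bullet> x)\<^sup>2)"
    proof -
      have "(norm X)\<^sup>2 = (x $ 2)\<^sup>2 + (x $ 3)\<^sup>2 + (x $ 4)\<^sup>2 + (x $ 5)\<^sup>2"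
        unfolding power2_norm_eq_inner by (simp add: X_def inner_vec_def sum_4 vector_4 flip: power2_eq_square)
      moreover have "q\<^sup>2 = x \<bullet> (V *v x)"
        using posdef_nonneg[OF V] by (simp add: q_def)
      ultimately show ?thesis
        by (simp only: V_def inner_Vmat)
    qed
    have q0: "0 \<le> q" using posdef_nonneg[OF V] by (simp add: q_def)
    have sum0: "0 \<le> (\<Sum>i=1..n. (psi a i \<bullet> x)\<^sup>2)" by (simp add: sum_nonneg)
    have t1: "(\<Sum>i=1..n. r i *\<^sub>R psi a i) \<bullet> x \<le> bias_bound \<rho> M3 * sqrt (real n) * q"
    proof -
      have "(\<Sum>i=1..n. r i *\<^sub>R psi a i) \<bullet> x = (\<Sum>i=1..n. r i * (psi a i \<bullet> x))"
        by (simp add: inner_sum_left)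
      also have "\<dots> \<le> (\<Sum>i=1..n. \<bar>r i\<bar> * \<bar>psi a i \<bullet> x\<bar>)"
        by (intro sum_mono) (simp flip: abs_mult)
      \<comment> \<open>The remainders are bounded only one by one, without cancellation;
        Cauchy--Schwarz over the samples then costs the factor \<open>sqrt (real n)\<close>.\<close>
      also have "\<dots> \<le> L2_set r {1..n} * L2_set (\<lambda>i. psi a i \<bullet> x) {1..n}"
        by (rule L2_set_mult_ineq)
      also have "\<dots> \<le> (bias_bound \<rho> M3 * sqrt (real n)) * q"
      proof (rule mult_mono)
        have "(\<Sum>i=1..n. (r i)\<^sup>2) \<le> (\<Sum>i=1..n. (bias_bound \<rho> M3)\<^sup>2)"
          using r by (intro sum_mono) (simp add: abs_le_square_iff[symmetric] b0)
        then have "L2_set r {1..n} \<le> sqrt (real n * (bias_bound \<rho> M3)\<^sup>2)"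
          unfolding L2_set_def by simp
        then show "L2_set r {1..n} \<le> bias_bound \<rho> M3 * sqrt (real n)"
          using b0 by (simp add: real_sqrt_mult mult.commute)
        have "(\<Sum>i=1..n. (psi a i \<bullet> x)\<^sup>2) \<le> q\<^sup>2"
          using q2 \<open>0 < lam\<close> by simp
        then show "L2_set (\<lambda>i. psi a i \<bullet> x) {1..n} \<le> q"
          unfolding L2_set_def using q0 by (simp add: real_le_lsqrt sum_nonneg)
      qed (use b0 in simp_all)
      finally show ?thesis .
    qed
    have t2: "(w 1 *\<^sub>R psi a 1) \<bullet> x \<le> c1 * q"
    proof -
      have "(psi a 1 \<bullet> x)\<^sup>2 \<le> (\<Sum>i=1..n. (psi a i \<bullet> x)\<^sup>2)"
        using \<open>1 \<le> n\<close> by (intro member_le_sum) auto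
      also have "\<dots> \<le> q\<^sup>2" using q2 \<open>0 < lam\<close> by simp
      finally have "\<bar>psi a 1 \<bullet> x\<bar> \<le> q" using q0 by (simp add: abs_le_square_iff[symmetric])
      then have "\<bar>w 1\<bar> * \<bar>psi a 1 \<bullet> x\<bar> \<le> c1 * q"
        using c1 by (intro mult_mono) auto
      moreover have "(w 1 *\<^sub>R psi a 1) \<bullet> x \<le> \<bar>w 1\<bar> * \<bar>psi a 1 \<bullet> x\<bar>"
        by (simp flip: abs_mult)
      ultimately show ?thesis by linarith
    qed
    have t3: "s \<bullet> x \<le> c2 * q"
      unfolding q_def by (rule inner_le_of_matrix_inv_norm_le[OF V]) (use s(2) c2 in \<open>simp_all add: V_def\<close>)
    have t4: "- ((Lambda lam *v t) \<bullet> x) \<le> sqrt lam * S_xi \<rho> G L * q"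
    proof -
      \<comment> \<open>No bound on the intercept of \<open>t\<close> is available.
        \<open>Lambda\<close> annihilates it, so the ridge bias involves only the harmonics \<eta>,
        whose norm \<open>S_xi\<close> controls.\<close>
      have "(Lambda lam *v t) \<bullet> x = lam * (\<eta> \<bullet> X)"
        unfolding inner_commute[of "Lambda lam *v t" x] inner_Lambda by (simp add: t_def X_def vector_4 vector_5 inner_vec_def sum_4 mult_ac)
      then have "- ((Lambda lam *v t) \<bullet> x) \<le> lam * \<bar>\<eta> \<bullet> X\<bar>"
        using \<open>0 < lam\<close> by (simp add: abs_real_def mult_le_0_iff not_less)
      also have "\<dots> \<le> lam * (norm \<eta> * norm X)"
        using \<open>0 < lam\<close> by (intro mult_left_mono Cauchy_Schwarz_ineq2) simp
      also have "\<dots> = (sqrt lam * norm \<eta>) * (sqrt lam * norm X)"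
        using \<open>0 < lam\<close> by simp
      also have "\<dots> \<le> (sqrt lam * S_xi \<rho> G L) * q"
      proof (intro mult_mono)
        have "(sqrt lam * norm X)\<^sup>2 \<le> q\<^sup>2"
          using q2 sum0 \<open>0 < lam\<close> by (simp add: power_mult_distrib)
        then show "sqrt lam * norm X \<le> q" using q0 by (rule power2_le_imp_le)
      qed (use S \<open>0 < lam\<close> in \<open>simp_all add: \<eta>_def S_xi_def\<close>)
      finally show ?thesis .
    qed
    have "(V *v (- e)) \<bullet> x \<le> bias_bound \<rho> M3 * sqrt (real n) * q + c1 * q + c2 * q + sqrt lam * S_xi \<rho> G L * q"
      unfolding Ve inner_diff_left inner_add_left using t1 t2 t3 t4 by linarith
    also have "\<dots> = radius \<rho> lam \<sigma> G L M3 \<delta> a n * q"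
      by (simp add: radius[symmetric] algebra_simps)
    finally show ?thesis by (simp add: q_def)
  qed
  define Q where "Q = e \<bullet> (V *v e)"
  have eV: "(- e) \<bullet> (V *v (- e)) = Q"
    by (simp add: Q_def linear_neg[OF matrix_vector_mul_linear])
  have Q0: "0 \<le> Q" unfolding Q_def by (rule posdef_nonneg[OF V])
  \<comment> \<open>Tested at \<open>- e\<close>, the left-hand side of \<open>bound\<close> is
    \<open>Q\<close> itself, and one factor \<open>sqrt Q\<close> cancels.\<close>
  have "Q \<le> radius \<rho> lam \<sigma> G L M3 \<delta> a n * sqrt Q"
    using bound[of "- e"] unfolding inner_commute[of "V *v (- e)" "- e"] eV .
  then have "sqrt Q * sqrt Q \<le> radius \<rho> lam \<sigma> G L M3 \<delta> a n * sqrt Q"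
    using Q0 by simp
  moreover have rad0: "0 \<le> radius \<rho> lam \<sigma> G L M3 \<delta> a n"
    unfolding radius[symmetric] using c1 c2 b0 \<open>0 < lam\<close> by (simp add: S_xi_def)
  ultimately have "sqrt Q \<le> radius \<rho> lam \<sigma> G L M3 \<delta> a n"
  proof (cases "Q = 0")
    case False
    with Q0 have "0 < sqrt Q" by simp
    then show ?thesis
      using \<open>sqrt Q * sqrt Q \<le> _\<close> by (simp only: mult_le_cancel_right_pos)
  qed simp
  then have Qle: "Q \<le> (radius \<rho> lam \<sigma> G L M3 \<delta> a n)\<^sup>2"
    by (rule sqrt_le_D)
  have "Gmat \<rho> *v t = g"
    using \<open>0 < \<rho>\<close> by (simp add: Gmat_def t_def matrix_vector_mult_def sum_5 vector_5 vec_eq_iff forall_2 \<eta>_def vector_4)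
  then have "g - ghat \<rho> lam a y n = Gmat \<rho> *v e"
    by (simp add: ghat_def e_def matrix_vector_mult_diff_distrib)
  moreover have "(Gmat \<rho> *v e) \<bullet> (matrix_inv (Pmat \<rho> lam a n) *v (Gmat \<rho> *v e)) \<le> Q"
    unfolding Q_def Pmat_def V_def
    by (rule projected_norm_le[OF V[unfolded V_def] posdef_Pmat[unfolded Pmat_def]]) fact+
  ultimately show ?thesis
    using Qle by (simp add: conf_set_def flip: g_def)
qed

section \<open>Growth of the determinant and of the self-normalised noise\<close>

lemma det_Vmat_Suc:
  assumes "0 < lam" "1 \<le> n"
  shows "det (Vmat lam a (Suc n)) = det (Vmat lam a n) *
    (1 + psi a (Suc n) \<bullet> (matrix_inv (Vmat lam a n) *v psi a (Suc n)))"
  unfolding Vmat_Suc by (rule det_plus_outer[OF posdef_invertible[OF posdef_Vmat[OF assms]]])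

lemma det_Vmat_mono:
  assumes "0 < lam" "1 \<le> n"
  shows "0 < det (Vmat lam a 1) \<and> det (Vmat lam a 1) \<le> det (Vmat lam a n)"
  using assms(2)
proof (induction n rule: dec_induct)
  case base
  have "det (Vmat lam a 1) = (\<Prod>i\<in>(UNIV::5 set). if i = 1 then 1 else lam)"
    unfolding Vmat_1 by (subst det_diagonal) auto
  also have "\<dots> > 0" using assms(1) by (intro prod_pos) auto
  finally show ?case by simp
next
  case (step n)
  have "0 \<le> psi a (Suc n) \<bullet> (matrix_inv (Vmat lam a n) *v psi a (Suc n))"
    by (rule posdef_nonneg[OF posdef_matrix_inv[OF posdef_Vmat[OF assms(1)]]]) (use step in simp)
  then have "det (Vmat lam a n) * 1 \<le> det (Vmat lam a (Suc n))"
    unfolding det_Vmat_Suc[OF assms(1) step.hyps(1)] using step by (intro mult_left_mono) auto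
  then show ?case using step by simp
qed

text \<open>The sum starts at 2 because the first sample is spent on the prior precision
  \<open>Vmat lam a 1\<close>; the sum is therefore zero at \<open>n = 1\<close>.\<close>

definition noise_sum :: "(nat \<Rightarrow> real) \<Rightarrow> (nat \<Rightarrow> real) \<Rightarrow> nat \<Rightarrow> real^5" where
  "noise_sum a w n = (\<Sum>i=2..n. w i *\<^sub>R psi a i)"

definition noise_quad :: "real \<Rightarrow> (nat \<Rightarrow> real) \<Rightarrow> (nat \<Rightarrow> real) \<Rightarrow> nat \<Rightarrow> real" where
  "noise_quad lam a w n = noise_sum a w n \<bullet> (matrix_inv (Vmat lam a n) *v noise_sum a w n)"

text \<open>This is the value of the Gaussian mixture of the exponential martingales with prior precision
  \<open>Vmat lam a 1\<close>.\<close>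

definition mixture :: "real \<Rightarrow> real \<Rightarrow> (nat \<Rightarrow> real) \<Rightarrow> (nat \<Rightarrow> real) \<Rightarrow> nat \<Rightarrow> real" where
  "mixture \<sigma> lam a w n = exp (noise_quad lam a w n / (2 * \<sigma>\<^sup>2)) * sqrt (det (Vmat lam a 1) / det (Vmat lam a n))"

lemma mixture_1: "0 < lam \<Longrightarrow> mixture \<sigma> lam a w 1 = 1"
  using det_Vmat_mono[of lam 1 a] by (simp add: mixture_def noise_quad_def noise_sum_def)

text \<open>\<open>m\<close> and \<open>c\<close> are mean and variance, in units of \<sigma>, of
  the next regressor's product with a Gaussian coefficient vector of mean
  \<open>matrix_inv V *v S\<close> and covariance \<open>\<sigma>\<^sup>2\<close> times
  \<open>matrix_inv V\<close>, the posterior after \<open>n\<close> samples. Dividing the noise by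
  \<sigma> gives the factor the form computed in \<open>gaussian_mixture_integral\<close>.\<close>

lemma mixture_Suc:
  fixes \<sigma> lam :: real and a w :: "nat \<Rightarrow> real"
  assumes "0 < lam" "1 \<le> n" "0 < \<sigma>"
  defines "c \<equiv> psi a (Suc n) \<bullet> (matrix_inv (Vmat lam a n) *v psi a (Suc n))"
    and "m \<equiv> (psi a (Suc n) \<bullet> (matrix_inv (Vmat lam a n) *v noise_sum a w n)) / \<sigma>"
    and "x \<equiv> w (Suc n) / \<sigma>"
  shows "mixture \<sigma> lam a w (Suc n) = mixture \<sigma> lam a w n * (exp ((c * x\<^sup>2 + 2 * m * x - m\<^sup>2) / (2 * (1 + c))) / sqrt (1 + c))"
proof -
  note V = posdef_Vmat[OF assms(1,2), of a]
  have c0: "0 \<le> c" unfolding c_def by (rule posdef_nonneg[OF posdef_matrix_inv[OF V]])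
  have sum: "noise_sum a w (Suc n) = noise_sum a w n + w (Suc n) *\<^sub>R psi a (Suc n)"
    using assms(2) by (simp add: noise_sum_def)
  define m' where "m' = m * \<sigma>"
  define x' where "x' = x * \<sigma>"
  have m': "psi a (Suc n) \<bullet> (matrix_inv (Vmat lam a n) *v noise_sum a w n) = m'" and x': "w (Suc n) = x'"
    using assms(3) by (simp_all add: m'_def x'_def m_def x_def)
  have "noise_quad lam a w (Suc n) = noise_quad lam a w n + (c * x'\<^sup>2 + 2 * m' * x' - m'\<^sup>2) / (1 + c)"
    unfolding noise_quad_def sum Vmat_Suc
    using rank_one_update_quadratic[OF V, of "noise_sum a w n" "w (Suc n)" "psi a (Suc n)"]
    by (simp only: c_def[symmetric] m' x')
  also have "\<dots> = noise_quad lam a w n + (2 * \<sigma>\<^sup>2) * ((c * x\<^sup>2 + 2 * m * x - m\<^sup>2) / (2 * (1 + c)))"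
    using c0 by (simp add: m'_def x'_def field_simps power2_eq_square)
  finally have "noise_quad lam a w (Suc n) / (2 * \<sigma>\<^sup>2) = noise_quad lam a w n / (2 * \<sigma>\<^sup>2) + (c * x\<^sup>2 + 2 * m * x - m\<^sup>2) / (2 * (1 + c))"
    using assms(3) by (simp add: add_divide_distrib)
  moreover have "sqrt (det (Vmat lam a 1) / det (Vmat lam a (Suc n))) = sqrt (det (Vmat lam a 1) / det (Vmat lam a n)) / sqrt (1 + c)"
    unfolding det_Vmat_Suc[OF assms(1,2)] c_def[symmetric] by (simp add: real_sqrt_divide real_sqrt_mult)
  ultimately show ?thesis
    by (simp only: mixture_def exp_add) simp
qed

text \<open>Logarithms are taken on the complement of Ville's event. The threshold
  \<open>2 / \<delta>\<close> is the reciprocal of the level \<open>\<delta> / 2\<close> and is the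
  source of the 2 inside the second logarithm of \<open>radius\<close>.\<close>

lemma noise_quad_le:
  assumes "0 < lam" "1 \<le> n" "0 < \<sigma>" "0 < \<delta>" "mixture \<sigma> lam a w n \<le> 2 / \<delta>"
  shows "noise_quad lam a w n \<le> 2 * \<sigma>\<^sup>2 * ln (2 * sqrt (det (Vmat lam a n)) / (\<delta> * sqrt (det (Vmat lam a 1))))"
proof -
  define D1 D where "D1 = sqrt (det (Vmat lam a 1))" and "D = sqrt (det (Vmat lam a n))"
  have D: "0 < D1" "0 < D" using det_Vmat_mono[OF assms(1,2), of a] by (simp_all add: D1_def D_def)
  have "exp (noise_quad lam a w n / (2 * \<sigma>\<^sup>2)) * (D1 / D) \<le> 2 / \<delta>"
    using assms(5) by (simp add: mixture_def D1_def D_def real_sqrt_divide)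
  then have "exp (noise_quad lam a w n / (2 * \<sigma>\<^sup>2)) \<le> 2 * D / (\<delta> * D1)"
    using D assms(4) by (simp add: field_simps)
  then have "noise_quad lam a w n / (2 * \<sigma>\<^sup>2) \<le> ln (2 * D / (\<delta> * D1))"
    using D assms(4) by (subst ln_ge_iff) simp_all
  then show ?thesis
    using assms(3) by (simp add: D_def D1_def field_simps)
qed

lemma gradient_covered_of_noise:
  assumes field: "field_assumption F p0 pstar G L M3 \<Delta>0"
    and pos: "0 < \<rho>" "0 \<le> \<sigma>" "0 < lam" "0 < \<delta>" "\<delta> < 1" "1 \<le> n"
    and meas: "\<And>i. 1 \<le> i \<Longrightarrow> y i = F (p + \<rho> *\<^sub>R phi (\<theta> + a i)) + w i"
    and w1: "\<bar>w 1\<bar> \<le> \<sigma> * sqrt (2 * ln (4 / \<delta>))"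
    and quad: "noise_quad lam a w n \<le> 2 * \<sigma>\<^sup>2 * ln (2 * sqrt (det (Vmat lam a n)) / (\<delta> * sqrt (det (Vmat lam a 1))))"
  shows "local_grad F p \<theta> \<in> conf_set \<rho> lam \<sigma> G L M3 \<delta> a y n"
proof -
  let ?c2 = "\<sigma> * sqrt (2 * ln (2 * sqrt (det (Vmat lam a n)) / (\<delta> * sqrt (det (Vmat lam a 1)))))"
  define D1 D where "D1 = sqrt (det (Vmat lam a 1))" and "D = sqrt (det (Vmat lam a n))"
  have D: "0 < D1" "D1 \<le> D" using det_Vmat_mono[OF pos(3,6), of a] by (simp_all add: D1_def D_def)
  \<comment> \<open>As \<delta> is below 1 and the determinant does not decrease, the argument of
    the logarithm is at least 1; hence squaring \<open>?c2\<close> gives the logarithm back.\<close>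
  have "\<delta> * D1 \<le> 1 * D1" using D pos by (intro mult_right_mono) auto
  then have "\<delta> * D1 \<le> 2 * D" using D by linarith
  then have "1 \<le> 2 * D / (\<delta> * D1)"
    using D pos by (simp add: le_divide_eq)
  then have l0: "0 \<le> ln (2 * D / (\<delta> * D1))" by (rule ln_ge_zero)
  show ?thesis
  proof (rule gradient_covered[OF field pos(1,3,6), where y = y and a = a and w = w and p = p and \<theta> = \<theta>,
        OF meas w1 _ noise_sum_def])
    show "0 \<le> ?c2" using l0 pos by (simp add: D_def D1_def)
    show "noise_sum a w n \<bullet> (matrix_inv (Vmat lam a n) *v noise_sum a w n) \<le> ?c2\<^sup>2"
      using quad l0 by (simp add: noise_quad_def power_mult_distrib D_def D1_def mult_ac)
    show "\<sigma> * sqrt (2 * ln (4 / \<delta>)) + ?c2 + sqrt lam * S_xi \<rho> G L + bias_bound \<rho> M3 * sqrt (real n)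
      = radius \<rho> lam \<sigma> G L M3 \<delta> a n"
      by (simp add: radius_def)
  qed
qed

section \<open>Conditionally sub-Gaussian noise and Ville's inequality\<close>

text \<open>Completing the square in \<open>u\<close> turns the integrand into a constant times a
  normal density with variance \<open>1 / (1 + a)\<close> and mean \<mu>. The standard deviation
  \<open>s\<close> contributes the denominator \<open>sqrt (1 + a)\<close>.\<close>

lemma gaussian_mixture_integral:
  fixes a m w :: real
  assumes "0 \<le> a"
  shows "(\<integral>\<^sup>+u. ennreal (std_normal_density u) * ennreal (exp ((m + sqrt a * u) * w - (m + sqrt a * u)\<^sup>2 / 2)) \<partial>lborel)
    = ennreal (exp ((a * w\<^sup>2 + 2 * m * w - m\<^sup>2) / (2 * (1 + a))) / sqrt (1 + a))"
proof -
  define r where "r = sqrt a"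
  have a: "a = r\<^sup>2" using assms by (simp add: r_def)
  have pos: "0 < 1 + r\<^sup>2" by (simp add: add_pos_nonneg)
  define c where "c = exp ((r\<^sup>2 * w\<^sup>2 + 2 * m * w - m\<^sup>2) / (2 * (1 + r\<^sup>2))) / sqrt (1 + r\<^sup>2)"
  define \<mu> where "\<mu> = r * (w - m) / (1 + r\<^sup>2)"
  define s where "s = 1 / sqrt (1 + r\<^sup>2)"
  have s: "0 < s" "s\<^sup>2 = 1 / (1 + r\<^sup>2)" using pos by (simp_all add: s_def power_divide)
  have expo: "- u\<^sup>2 / 2 + ((m + r * u) * w - (m + r * u)\<^sup>2 / 2)
      = (r\<^sup>2 * w\<^sup>2 + 2 * m * w - m\<^sup>2) / (2 * (1 + r\<^sup>2)) + - (u - \<mu>)\<^sup>2 / (2 * s\<^sup>2)" for u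
  proof -
    have mu: "\<mu> * (1 + r\<^sup>2) = r * (w - m)" using pos by (simp add: \<mu>_def)
    have "(u - \<mu>)\<^sup>2 / (2 * s\<^sup>2) * (2 * (1 + r\<^sup>2)) = (u * (1 + r\<^sup>2) - \<mu> * (1 + r\<^sup>2))\<^sup>2"
      using pos by (simp add: s(2) flip: left_diff_distrib) (simp add: power2_eq_square field_simps)
    also have "\<dots> = (u * (1 + r\<^sup>2) - r * (w - m))\<^sup>2" unfolding mu ..
    finally have sq: "(u - \<mu>)\<^sup>2 / (2 * s\<^sup>2) = (u * (1 + r\<^sup>2) - r * (w - m))\<^sup>2 / (2 * (1 + r\<^sup>2))"
      using pos by (simp add: eq_divide_eq)
    have "(- u\<^sup>2 / 2 + ((m + r * u) * w - (m + r * u)\<^sup>2 / 2)) * (2 * (1 + r\<^sup>2))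
      = (r\<^sup>2 * w\<^sup>2 + 2 * m * w - m\<^sup>2) - (u * (1 + r\<^sup>2) - r * (w - m))\<^sup>2"
      by (simp add: power2_eq_square algebra_simps)
    then have "- u\<^sup>2 / 2 + ((m + r * u) * w - (m + r * u)\<^sup>2 / 2)
      = ((r\<^sup>2 * w\<^sup>2 + 2 * m * w - m\<^sup>2) - (u * (1 + r\<^sup>2) - r * (w - m))\<^sup>2) / (2 * (1 + r\<^sup>2))"
      using pos by (simp add: eq_divide_eq)
    then show ?thesis
      by (simp add: sq diff_divide_distrib)
  qed
  have norm: "1 / sqrt (2 * pi) = 1 / sqrt (1 + r\<^sup>2) * (1 / sqrt (2 * pi * s\<^sup>2))"
    using pos by (simp add: s(2) real_sqrt_divide real_sqrt_mult)
  have "std_normal_density u * exp ((m + r * u) * w - (m + r * u)\<^sup>2 / 2) = c * normal_density \<mu> s u" for u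
  proof -
    have "std_normal_density u * exp ((m + r * u) * w - (m + r * u)\<^sup>2 / 2)
      = 1 / sqrt (2 * pi) * exp (- u\<^sup>2 / 2 + ((m + r * u) * w - (m + r * u)\<^sup>2 / 2))"
      by (simp only: std_normal_density_def mult.assoc exp_add)
    also have "\<dots> = c * normal_density \<mu> s u"
      unfolding expo norm by (simp only: c_def normal_density_def exp_add) simp
    finally show ?thesis .
  qed
  then have "(\<integral>\<^sup>+u. ennreal (std_normal_density u) * ennreal (exp ((m + r * u) * w - (m + r * u)\<^sup>2 / 2)) \<partial>lborel)
    = (\<integral>\<^sup>+u. ennreal c * ennreal (normal_density \<mu> s u) \<partial>lborel)"
    by (simp flip: ennreal_mult'')
  also have "\<dots> = ennreal c * (\<integral>\<^sup>+u. ennreal (normal_density \<mu> s u) \<partial>lborel)"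
    by (simp add: nn_integral_cmult)
  also have "(\<integral>\<^sup>+u. ennreal (normal_density \<mu> s u) \<partial>lborel) = 1"
    using s(1) by (simp add: nn_integral_eq_integral)
  finally show ?thesis
    using assms by (simp add: c_def r_def)
qed

section \<open>Consequences of a conditional sub-Gaussian bound\<close>

lemma sigma_finite_subalgebra_of_prob_space:
  assumes "prob_space M" and "subalgebra M F"
  shows "sigma_finite_subalgebra M F"
  using assms by (intro finite_measure_subalgebra_is_sigma_finite)
    (simp add: finite_measure_subalgebra_def finite_measure_subalgebra_axioms_def prob_space.finite_measure)

text \<open>\<open>nn_cond_exp\<close> provides the conditional moment generating function without a
  prior proof that the exponential is integrable. The exceptional null set may depend on
  \<open>s\<close>, so a random tilt cannot simply be substituted.\<close>

definition subgaussian_given :: "'w measure \<Rightarrow> 'w measure \<Rightarrow> real \<Rightarrow> ('w \<Rightarrow> real) \<Rightarrow> bool" where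
  "subgaussian_given M F \<sigma> w \<longleftrightarrow> w \<in> borel_measurable M \<and>
    (\<forall>s. AE \<omega> in M. nn_cond_exp M F (\<lambda>\<omega>. ennreal (exp (s * w \<omega>))) \<omega> \<le> ennreal (exp (s\<^sup>2 * \<sigma>\<^sup>2 / 2)))"

lemma subgaussian_given_scale:
  assumes "subgaussian_given M F \<sigma> w" and "0 < \<sigma>"
  shows "subgaussian_given M F 1 (\<lambda>\<omega>. w \<omega> / \<sigma>)"
  unfolding subgaussian_given_def
proof (intro conjI allI)
  show "(\<lambda>\<omega>. w \<omega> / \<sigma>) \<in> borel_measurable M"
    using assms by (auto simp: subgaussian_given_def)
  fix s
  have "AE \<omega> in M. nn_cond_exp M F (\<lambda>\<omega>. ennreal (exp ((s / \<sigma>) * w \<omega>))) \<omega> \<le> ennreal (exp ((s / \<sigma>)\<^sup>2 * \<sigma>\<^sup>2 / 2))"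
    using assms(1) unfolding subgaussian_given_def by blast
  then show "AE \<omega> in M. nn_cond_exp M F (\<lambda>\<omega>. ennreal (exp (s * (w \<omega> / \<sigma>)))) \<omega> \<le> ennreal (exp (s\<^sup>2 * 1\<^sup>2 / 2))"
    using assms(2) by (simp add: power_divide)
qed

context
  fixes M F :: "'w measure"
  assumes M: "prob_space M" and sub: "subalgebra M F"
begin

text \<open>The weight \<open>Z\<close> carries the past, such as an event or the current value of a
  process, and moves through the conditional expectation. The bounds below all rest on this
  integrated form.\<close>

lemma subgaussian_const:
  assumes w: "subgaussian_given M F \<sigma> w" and Z: "Z \<in> borel_measurable F"
  shows "(\<integral>\<^sup>+\<omega>. Z \<omega> * ennreal (exp (s * w \<omega>)) \<partial>M) \<le> (\<integral>\<^sup>+\<omega>. Z \<omega> \<partial>M) * ennreal (exp (s\<^sup>2 * \<sigma>\<^sup>2 / 2))"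
proof -
  interpret sigma_finite_subalgebra M F
    by (rule sigma_finite_subalgebra_of_prob_space[OF M sub])
  have [measurable]: "w \<in> borel_measurable M" "Z \<in> borel_measurable F"
    using w Z by (auto simp: subgaussian_given_def)
  note [measurable] = measurable_from_subalg[OF sub Z]
  have "(\<integral>\<^sup>+\<omega>. Z \<omega> * ennreal (exp (s * w \<omega>)) \<partial>M)
    = (\<integral>\<^sup>+\<omega>. Z \<omega> * nn_cond_exp M F (\<lambda>\<omega>. ennreal (exp (s * w \<omega>))) \<omega> \<partial>M)"
    by (rule nn_cond_exp_intg[symmetric]) measurable
  also have "\<dots> \<le> (\<integral>\<^sup>+\<omega>. Z \<omega> * ennreal (exp (s\<^sup>2 * \<sigma>\<^sup>2 / 2)) \<partial>M)"
  proof (rule nn_integral_mono_AE)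
    have "AE \<omega> in M. nn_cond_exp M F (\<lambda>\<omega>. ennreal (exp (s * w \<omega>))) \<omega> \<le> ennreal (exp (s\<^sup>2 * \<sigma>\<^sup>2 / 2))"
      using w by (simp add: subgaussian_given_def)
    then show "AE \<omega> in M. Z \<omega> * nn_cond_exp M F (\<lambda>\<omega>. ennreal (exp (s * w \<omega>))) \<omega> \<le> Z \<omega> * ennreal (exp (s\<^sup>2 * \<sigma>\<^sup>2 / 2))"
      by eventually_elim (rule mult_left_mono, simp_all)
  qed
  finally show ?thesis
    by (simp add: nn_integral_multc)
qed

text \<open>On each level set of \<open>X\<close> the tilt is a constant \<open>x\<close>. The level
  set and \<open>exp (- x\<^sup>2 / 2)\<close> are absorbed into the weight, where the latter
  cancels the bound \<open>exp (x\<^sup>2 / 2)\<close> of the constant case.\<close>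

lemma subgaussian_simple:
  assumes w: "subgaussian_given M F 1 w" and Z: "Z \<in> borel_measurable F" and X: "simple_function F X"
  shows "(\<integral>\<^sup>+\<omega>. Z \<omega> * ennreal (exp (X \<omega> * w \<omega> - (X \<omega>)\<^sup>2 / 2)) \<partial>M) \<le> (\<integral>\<^sup>+\<omega>. Z \<omega> \<partial>M)"
proof -
  have [measurable]: "w \<in> borel_measurable M" "Z \<in> borel_measurable F"
    using w Z by (auto simp: subgaussian_given_def)
  have sp: "space F = space M" using sub by (simp add: subalgebra_def)
  define A where "A x = X -` {x} \<inter> space F" for x
  define I where "I = X ` space F"
  have I: "finite I" and A: "\<And>x. x \<in> I \<Longrightarrow> A x \<in> sets F"
    using X by (auto simp: simple_function_def I_def A_def)
  define Y where "Y x \<omega> = Z \<omega> * indicator (A x) \<omega> * ennreal (exp (- x\<^sup>2 / 2))" for x \<omega>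
  have Y: "Y x \<in> borel_measurable F" if "x \<in> I" for x
    unfolding Y_def using A[OF that] by measurable
  note YM = measurable_from_subalg[OF sub Y] and ZM = measurable_from_subalg[OF sub Z]
  have AM: "A x \<in> sets M" if "x \<in> I" for x
    using A[OF that] sub by (auto simp: subalgebra_def)
  have part: "(\<Sum>x\<in>I. indicator (A x) \<omega> * g x) = g (X \<omega>)" if "\<omega> \<in> space M" for \<omega> and g :: "real \<Rightarrow> ennreal"
  proof -
    have "(\<Sum>x\<in>I. indicator (A x) \<omega> * g x) = (\<Sum>x\<in>I. if x = X \<omega> then g x else 0)"
      using that by (intro sum.cong) (auto simp: A_def sp)
    also have "\<dots> = g (X \<omega>)" using that I by (simp add: I_def sp)
    finally show ?thesis .
  qed
  have "(\<integral>\<^sup>+\<omega>. Z \<omega> * ennreal (exp (X \<omega> * w \<omega> - (X \<omega>)\<^sup>2 / 2)) \<partial>M)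
    = (\<integral>\<^sup>+\<omega>. (\<Sum>x\<in>I. Y x \<omega> * ennreal (exp (x * w \<omega>))) \<partial>M)"
  proof (rule nn_integral_cong)
    fix \<omega> assume "\<omega> \<in> space M"
    then have "Z \<omega> * ennreal (exp (X \<omega> * w \<omega> - (X \<omega>)\<^sup>2 / 2))
      = Z \<omega> * (\<Sum>x\<in>I. indicator (A x) \<omega> * ennreal (exp (x * w \<omega> - x\<^sup>2 / 2)))"
      by (subst part) auto
    also have "\<dots> = (\<Sum>x\<in>I. Y x \<omega> * ennreal (exp (x * w \<omega>)))"
      unfolding sum_distrib_left Y_def
      by (intro sum.cong refl) (simp add: mult_ac flip: ennreal_mult'' exp_add)
    finally show "Z \<omega> * ennreal (exp (X \<omega> * w \<omega> - (X \<omega>)\<^sup>2 / 2)) = (\<Sum>x\<in>I. Y x \<omega> * ennreal (exp (x * w \<omega>)))" .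
  qed
  also have "\<dots> = (\<Sum>x\<in>I. \<integral>\<^sup>+\<omega>. Y x \<omega> * ennreal (exp (x * w \<omega>)) \<partial>M)"
    by (intro nn_integral_sum borel_measurable_times_ennreal YM) measurable
  also have "\<dots> \<le> (\<Sum>x\<in>I. (\<integral>\<^sup>+\<omega>. Y x \<omega> \<partial>M) * ennreal (exp (x\<^sup>2 * 1\<^sup>2 / 2)))"
    by (intro sum_mono subgaussian_const[OF w] Y)
  also have "\<dots> = (\<Sum>x\<in>I. \<integral>\<^sup>+\<omega>. Y x \<omega> * ennreal (exp (x\<^sup>2 / 2)) \<partial>M)"
    using YM by (intro sum.cong refl) (simp add: nn_integral_multc)
  also have "\<dots> = (\<Sum>x\<in>I. \<integral>\<^sup>+\<omega>. Z \<omega> * indicator (A x) \<omega> \<partial>M)"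
    unfolding Y_def by (simp add: mult.assoc flip: ennreal_mult'' exp_add)
  also have "\<dots> = (\<integral>\<^sup>+\<omega>. (\<Sum>x\<in>I. Z \<omega> * indicator (A x) \<omega>) \<partial>M)"
    by (intro nn_integral_sum[symmetric] borel_measurable_times_ennreal ZM borel_measurable_indicator AM)
  also have "\<dots> = (\<integral>\<^sup>+\<omega>. Z \<omega> \<partial>M)"
    using part[of _ "\<lambda>_. 1"] by (intro nn_integral_cong) (simp flip: sum_distrib_left)
  finally show ?thesis .
qed

text \<open>The compensator \<open>X\<^sup>2 / 2\<close> makes the bound for simple \<open>X\<close> free of \<open>X\<close>, so Fatou's lemma
  needs no domination.\<close>

lemma subgaussian_adapted:
  assumes w: "subgaussian_given M F 1 w" and Z: "Z \<in> borel_measurable F" and X: "X \<in> borel_measurable F"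
  shows "(\<integral>\<^sup>+\<omega>. Z \<omega> * ennreal (exp (X \<omega> * w \<omega> - (X \<omega>)\<^sup>2 / 2)) \<partial>M) \<le> (\<integral>\<^sup>+\<omega>. Z \<omega> \<partial>M)"
proof -
  have sp: "space F = space M" using sub by (simp add: subalgebra_def)
  have [measurable]: "w \<in> borel_measurable M"
    using w by (auto simp: subgaussian_given_def)
  note [measurable] = measurable_from_subalg[OF sub Z] measurable_from_subalg[OF sub X]
  obtain f where f: "\<And>i. simple_function F (f i)" "\<And>\<omega>. \<omega> \<in> space F \<Longrightarrow> (\<lambda>i. f i \<omega>) \<longlonglongrightarrow> X \<omega>"
    using borel_measurable_implies_sequence_metric[OF X, of 0] by blast
  note [measurable] = measurable_from_subalg[OF sub borel_measurable_simple_function[OF f(1)]]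
  have "(\<integral>\<^sup>+\<omega>. Z \<omega> * ennreal (exp (X \<omega> * w \<omega> - (X \<omega>)\<^sup>2 / 2)) \<partial>M)
    = (\<integral>\<^sup>+\<omega>. liminf (\<lambda>i. Z \<omega> * ennreal (exp (f i \<omega> * w \<omega> - (f i \<omega>)\<^sup>2 / 2))) \<partial>M)"
  proof (rule nn_integral_cong)
    fix \<omega> assume "\<omega> \<in> space M"
    then have "(\<lambda>i. f i \<omega>) \<longlonglongrightarrow> X \<omega>" using f(2) sp by simp
    then have "(\<lambda>i. exp (f i \<omega> * w \<omega> - (f i \<omega>)\<^sup>2 / 2)) \<longlonglongrightarrow> exp (X \<omega> * w \<omega> - (X \<omega>)\<^sup>2 / 2)"
      by (intro tendsto_intros) simp_all
    then have "(\<lambda>i. Z \<omega> * ennreal (exp (f i \<omega> * w \<omega> - (f i \<omega>)\<^sup>2 / 2))) \<longlonglongrightarrow> Z \<omega> * ennreal (exp (X \<omega> * w \<omega> - (X \<omega>)\<^sup>2 / 2))"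
      by (intro tendsto_mult_ennreal tendsto_const tendsto_ennrealI) simp_all
    then show "Z \<omega> * ennreal (exp (X \<omega> * w \<omega> - (X \<omega>)\<^sup>2 / 2)) = liminf (\<lambda>i. Z \<omega> * ennreal (exp (f i \<omega> * w \<omega> - (f i \<omega>)\<^sup>2 / 2)))"
      by (rule lim_imp_Liminf[OF trivial_limit_sequentially, symmetric])
  qed
  also have "\<dots> \<le> liminf (\<lambda>i. \<integral>\<^sup>+\<omega>. Z \<omega> * ennreal (exp (f i \<omega> * w \<omega> - (f i \<omega>)\<^sup>2 / 2)) \<partial>M)"
    by (rule nn_integral_liminf) measurable
  also have "\<dots> \<le> liminf (\<lambda>i::nat. \<integral>\<^sup>+\<omega>. Z \<omega> \<partial>M)"
    by (intro Liminf_mono always_eventually allI subgaussian_simple[OF w Z] f(1))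
  also have "\<dots> = (\<integral>\<^sup>+\<omega>. Z \<omega> \<partial>M)"
    by (simp add: Liminf_const)
  finally show ?thesis .
qed

text \<open>For each fixed \<open>u\<close> the tilt \<open>m + sqrt a * u\<close> is measurable
  with respect to the past, so the bound for such tilts applies before averaging over
  \<open>u\<close>; Tonelli exchanges the two integrals.\<close>

lemma subgaussian_mixture:
  assumes w: "subgaussian_given M F 1 w" and Z: "Z \<in> borel_measurable F"
    and m: "m \<in> borel_measurable F" and a: "a \<in> borel_measurable F" and a0: "\<And>\<omega>. \<omega> \<in> space M \<Longrightarrow> 0 \<le> a \<omega>"
  shows "(\<integral>\<^sup>+\<omega>. Z \<omega> * ennreal (exp ((a \<omega> * (w \<omega>)\<^sup>2 + 2 * m \<omega> * w \<omega> - (m \<omega>)\<^sup>2) / (2 * (1 + a \<omega>))) / sqrt (1 + a \<omega>)) \<partial>M)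
    \<le> (\<integral>\<^sup>+\<omega>. Z \<omega> \<partial>M)"
proof -
  interpret prob_space M by (rule M)
  interpret pair_sigma_finite lborel M ..
  have [measurable]: "w \<in> borel_measurable M"
    using w by (auto simp: subgaussian_given_def)
  note [measurable] = measurable_from_subalg[OF sub Z] measurable_from_subalg[OF sub m] measurable_from_subalg[OF sub a]
  let ?X = "\<lambda>u \<omega>. m \<omega> + sqrt (a \<omega>) * u"
  have "(\<integral>\<^sup>+\<omega>. Z \<omega> * ennreal (exp ((a \<omega> * (w \<omega>)\<^sup>2 + 2 * m \<omega> * w \<omega> - (m \<omega>)\<^sup>2) / (2 * (1 + a \<omega>))) / sqrt (1 + a \<omega>)) \<partial>M)
    = (\<integral>\<^sup>+\<omega>. Z \<omega> * (\<integral>\<^sup>+u. ennreal (std_normal_density u) * ennreal (exp (?X u \<omega> * w \<omega> - (?X u \<omega>)\<^sup>2 / 2)) \<partial>lborel) \<partial>M)"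
    by (intro nn_integral_cong) (simp only: gaussian_mixture_integral a0)
  also have "\<dots> = (\<integral>\<^sup>+\<omega>. \<integral>\<^sup>+u. ennreal (std_normal_density u) * (Z \<omega> * ennreal (exp (?X u \<omega> * w \<omega> - (?X u \<omega>)\<^sup>2 / 2))) \<partial>lborel \<partial>M)"
    by (intro nn_integral_cong) (subst nn_integral_cmult[symmetric]; simp add: mult_ac)
  also have "\<dots> = (\<integral>\<^sup>+u. \<integral>\<^sup>+\<omega>. ennreal (std_normal_density u) * (Z \<omega> * ennreal (exp (?X u \<omega> * w \<omega> - (?X u \<omega>)\<^sup>2 / 2))) \<partial>M \<partial>lborel)"
    by (rule Fubini') measurable
  also have "\<dots> = (\<integral>\<^sup>+u. ennreal (std_normal_density u) * (\<integral>\<^sup>+\<omega>. Z \<omega> * ennreal (exp (?X u \<omega> * w \<omega> - (?X u \<omega>)\<^sup>2 / 2)) \<partial>M) \<partial>lborel)"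
    by (simp add: nn_integral_cmult)
  also have "\<dots> \<le> (\<integral>\<^sup>+u. ennreal (std_normal_density u) * (\<integral>\<^sup>+\<omega>. Z \<omega> \<partial>M) \<partial>lborel)"
  proof (rule nn_integral_mono, rule mult_left_mono)
    fix u :: real
    show "(\<integral>\<^sup>+\<omega>. Z \<omega> * ennreal (exp (?X u \<omega> * w \<omega> - (?X u \<omega>)\<^sup>2 / 2)) \<partial>M) \<le> (\<integral>\<^sup>+\<omega>. Z \<omega> \<partial>M)"
      by (intro subgaussian_adapted[OF w Z] borel_measurable_add borel_measurable_times
          borel_measurable_const measurable_compose[OF a borel_measurable_sqrt] m)
  qed simp
  also have "\<dots> = (\<integral>\<^sup>+\<omega>. Z \<omega> \<partial>M)"
    by (simp add: nn_integral_multc nn_integral_eq_integral)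
  finally show ?thesis .
qed

text \<open>Chernoff's bound at the optimal tilt. On the tail event the exponential is at least
  \<open>exp (t\<^sup>2)\<close>, its integral over \<open>A\<close> is at most
  \<open>exp (t\<^sup>2 / 2)\<close> times the measure of \<open>A\<close>, and \<open>t\<close>
  makes the quotient equal to \<open>\<delta> / 2\<close>. The sign \<open>c\<close> covers both
  tails.\<close>

lemma subgaussian_tail:
  assumes w: "subgaussian_given M F \<sigma> w" and A: "A \<in> sets F" and "0 < \<sigma>" and "0 < \<delta>" "\<delta> \<le> 1"
  shows "emeasure M {\<omega> \<in> A. \<sigma> * sqrt (2 * ln (2 / \<delta>)) < \<bar>w \<omega>\<bar>} \<le> ennreal \<delta> * emeasure M A"
proof -
  have [measurable]: "w \<in> borel_measurable M"
    using w by (auto simp: subgaussian_given_def)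
  have AM[measurable]: "A \<in> sets M" using A sub by (auto simp: subalgebra_def)
  define t where "t = sqrt (2 * ln (2 / \<delta>))"
  have t: "0 \<le> t" "t\<^sup>2 = 2 * ln (2 / \<delta>)"
    using assms by (simp_all add: t_def)
  have one: "emeasure M {\<omega> \<in> A. \<sigma> * t < c * w \<omega>} \<le> ennreal (\<delta> / 2) * emeasure M A" if c: "c\<^sup>2 = 1" for c
  proof -
    define s where "s = c * t / \<sigma>"
    have "emeasure M {\<omega> \<in> A. \<sigma> * t < c * w \<omega>} * ennreal (exp (t\<^sup>2)) = (\<integral>\<^sup>+\<omega>. indicator {\<omega> \<in> A. \<sigma> * t < c * w \<omega>} \<omega> * ennreal (exp (t\<^sup>2)) \<partial>M)"
      by (simp add: nn_integral_multc)
    also have "\<dots> \<le> (\<integral>\<^sup>+\<omega>. indicator A \<omega> * ennreal (exp (s * w \<omega>)) \<partial>M)"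
    proof (intro nn_integral_mono)
      fix \<omega>
      have "t\<^sup>2 \<le> s * w \<omega>" if "\<sigma> * t < c * w \<omega>"
      proof -
        have "\<sigma> * t * t \<le> c * w \<omega> * t" using that t by (intro mult_right_mono) auto
        then show ?thesis using \<open>0 < \<sigma>\<close> by (simp add: s_def power2_eq_square field_simps)
      qed
      then show "indicator {\<omega> \<in> A. \<sigma> * t < c * w \<omega>} \<omega> * ennreal (exp (t\<^sup>2)) \<le> indicator A \<omega> * ennreal (exp (s * w \<omega>))"
        by (auto simp: indicator_def)
    qed
    also have "\<dots> \<le> (\<integral>\<^sup>+\<omega>. indicator A \<omega> \<partial>M) * ennreal (exp (s\<^sup>2 * \<sigma>\<^sup>2 / 2))"
      by (intro subgaussian_const[OF w] borel_measurable_indicator A)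
    also have "s\<^sup>2 * \<sigma>\<^sup>2 = t\<^sup>2"
      using c \<open>0 < \<sigma>\<close> by (simp add: s_def power_divide power_mult_distrib)
    finally have "emeasure M {\<omega> \<in> A. \<sigma> * t < c * w \<omega>} * ennreal (exp (t\<^sup>2)) \<le> emeasure M A * ennreal (exp (t\<^sup>2 / 2))"
      by simp
    then have "emeasure M {\<omega> \<in> A. \<sigma> * t < c * w \<omega>} * ennreal (exp (t\<^sup>2)) * ennreal (exp (- t\<^sup>2)) \<le> emeasure M A * ennreal (exp (t\<^sup>2 / 2)) * ennreal (exp (- t\<^sup>2))"
      by (rule mult_right_mono) simp
    then have "emeasure M {\<omega> \<in> A. \<sigma> * t < c * w \<omega>} \<le> emeasure M A * ennreal (exp (- (t\<^sup>2 / 2)))"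
      by (simp add: mult.assoc flip: ennreal_mult'' exp_add)
    also have "exp (- (t\<^sup>2 / 2)) = \<delta> / 2"
      using assms by (simp add: t exp_minus)
    finally show ?thesis by (simp add: mult.commute)
  qed
  have "emeasure M {\<omega> \<in> A. \<sigma> * t < \<bar>w \<omega>\<bar>} \<le> emeasure M ({\<omega> \<in> A. \<sigma> * t < 1 * w \<omega>} \<union> {\<omega> \<in> A. \<sigma> * t < (-1) * w \<omega>})"
    by (intro emeasure_mono) (auto simp: abs_real_def split: if_splits)
  also have "\<dots> \<le> emeasure M {\<omega> \<in> A. \<sigma> * t < 1 * w \<omega>} + emeasure M {\<omega> \<in> A. \<sigma> * t < (-1) * w \<omega>}"
    by (intro emeasure_subadditive) measurable
  also have "\<dots> \<le> ennreal (\<delta> / 2) * emeasure M A + ennreal (\<delta> / 2) * emeasure M A"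
    by (intro add_mono one) simp_all
  also have "\<dots> = ennreal \<delta> * emeasure M A"
    using \<open>0 < \<delta>\<close> by (simp flip: distrib_right ennreal_plus)
  finally show ?thesis by (simp add: t_def)
qed

text \<open>With variance proxy zero the tilts 1 and -1 both have exponential integral at most 1,
  while the mean of the two exponentials exceeds 1 by at least a multiple of the squared
  noise.\<close>

lemma subgaussian_zero:
  assumes w: "subgaussian_given M F 0 w"
  shows "AE \<omega> in M. w \<omega> = 0"
proof -
  interpret prob_space M by (rule M)
  have [measurable]: "w \<in> borel_measurable M"
    using w by (auto simp: subgaussian_given_def)
  have b: "(\<integral>\<^sup>+\<omega>. ennreal (exp (s * w \<omega>)) \<partial>M) \<le> 1" for s
    using subgaussian_const[OF w, of "\<lambda>_. 1" s] by (simp add: emeasure_space_1)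
  have "1 + (\<integral>\<^sup>+\<omega>. ennreal ((w \<omega>)\<^sup>2 / 4) \<partial>M) = (\<integral>\<^sup>+\<omega>. 1 + ennreal ((w \<omega>)\<^sup>2 / 4) \<partial>M)"
    by (subst nn_integral_add) (simp_all add: emeasure_space_1)
  also have "\<dots> \<le> (\<integral>\<^sup>+\<omega>. ennreal (exp (1 * w \<omega>) / 2) + ennreal (exp ((-1) * w \<omega>) / 2) \<partial>M)"
  proof (intro nn_integral_mono)
    fix \<omega>
    \<comment> \<open>The quadratic Taylor bound serves the exponential with nonnegative argument
      and the tangent bound the other one; the linear terms cancel, and averaging leaves a quarter
      of the square.\<close>
    have "1 + (w \<omega>)\<^sup>2 / 4 \<le> (exp (w \<omega>) + exp (- w \<omega>)) / 2"
    proof (cases "0 \<le> w \<omega>")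
      case True
      then show ?thesis
        using exp_lower_Taylor_quadratic[of "w \<omega>"] exp_ge_add_one_self[of "- w \<omega>"] by simp
    next
      case False
      then show ?thesis
        using exp_lower_Taylor_quadratic[of "- w \<omega>"] exp_ge_add_one_self[of "w \<omega>"]
        by (simp del: exp_ge_add_one_self)
    qed
    then show "1 + ennreal ((w \<omega>)\<^sup>2 / 4) \<le> ennreal (exp (1 * w \<omega>) / 2) + ennreal (exp ((-1) * w \<omega>) / 2)"
      by (simp add: add_divide_distrib flip: ennreal_plus ennreal_1)
  qed
  also have "\<dots> = ennreal (1 / 2) * (\<integral>\<^sup>+\<omega>. ennreal (exp (1 * w \<omega>)) \<partial>M) + ennreal (1 / 2) * (\<integral>\<^sup>+\<omega>. ennreal (exp ((-1) * w \<omega>)) \<partial>M)"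
  proof -
    have half: "(\<integral>\<^sup>+\<omega>. ennreal (exp (s * w \<omega>) / 2) \<partial>M) = ennreal (1 / 2) * (\<integral>\<^sup>+\<omega>. ennreal (exp (s * w \<omega>)) \<partial>M)" for s
      by (subst nn_integral_cmult[symmetric], measurable)
        (intro nn_integral_cong, simp only: ennreal_mult[symmetric] exp_ge_zero, simp)
    show ?thesis
      unfolding half[symmetric] by (rule nn_integral_add) measurable
  qed
  also have "\<dots> \<le> ennreal (1 / 2) * 1 + ennreal (1 / 2) * 1"
    by (intro add_mono mult_left_mono b) simp_all
  also have "\<dots> = ennreal (1 / 2 + 1 / 2)"
    by (subst ennreal_plus) simp_all
  also have "\<dots> = 1"
    by simp
  finally have "1 + (\<integral>\<^sup>+\<omega>. ennreal ((w \<omega>)\<^sup>2 / 4) \<partial>M) \<le> 1 + 0"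
    by simp
  then have "(\<integral>\<^sup>+\<omega>. ennreal ((w \<omega>)\<^sup>2 / 4) \<partial>M) = 0"
    by (simp only: ennreal_add_left_cancel_le) simp
  then show ?thesis
    by (subst (asm) nn_integral_0_iff_AE) auto
qed

text \<open>The hypothesis is applied to the set where the conditional probability falls below
  \<open>1 - \<delta>\<close>, which belongs to \<open>F\<close>. There the deficit is positive, yet
  its integral is at most zero, so the set is null.\<close>

lemma real_cond_exp_indicator_ge:
  assumes E: "E \<in> sets M" and \<delta>: "0 < \<delta>"
    and bound: "\<And>A. A \<in> sets F \<Longrightarrow> emeasure M (A - E) \<le> ennreal \<delta> * emeasure M A"
  shows "AE \<omega> in M. 1 - \<delta> \<le> real_cond_exp M F (indicator E) \<omega>"
proof -
  interpret prob_space M by (rule M)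
  interpret sigma_finite_subalgebra M F
    by (rule sigma_finite_subalgebra_of_prob_space[OF M sub])
  have iE: "integrable M (indicator E :: _ \<Rightarrow> real)"
    using E by (simp add: integrable_indicator_iff less_top[symmetric])
  define f where "f = real_cond_exp M F (indicator E :: _ \<Rightarrow> real)"
  have [measurable]: "f \<in> borel_measurable F" "f \<in> borel_measurable M" by (simp_all add: f_def)
  have fi: "integrable M f" unfolding f_def by (rule real_cond_exp_int(1)[OF iE])
  define A where "A = {\<omega> \<in> space F. f \<omega> < 1 - \<delta>}"
  have A: "A \<in> sets F" unfolding A_def by measurable
  have AM[measurable]: "A \<in> sets M" using A sub by (auto simp: subalgebra_def)
  have "measure M (A - E) \<le> \<delta> * measure M A"
    using bound[OF A] \<delta> by (simp add: emeasure_eq_measure flip: ennreal_mult)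
  moreover have "measure M (A - E) = measure M A - measure M (A \<inter> E)"
    using E AM by (simp add: finite_measure_Diff')
  moreover have "measure M (A \<inter> E) = (\<integral>\<omega>\<in>A. f \<omega> \<partial>M)"
    using real_cond_exp_intA[OF iE A] E unfolding f_def set_lebesgue_integral_def
    by (simp add: indicator_inter_arith[symmetric])
  ultimately have le: "(1 - \<delta>) * measure M A \<le> (\<integral>\<omega>\<in>A. f \<omega> \<partial>M)"
    by (simp add: algebra_simps)
  define g where "g \<omega> = indicator A \<omega> * ((1 - \<delta>) - f \<omega>)" for \<omega>
  have gi: "integrable M g"
    unfolding g_def using fi by (intro integrable_mult_indicator[where 'b=real, simplified]) auto
  have fA: "integrable M (\<lambda>\<omega>. indicator A \<omega> * f \<omega>)"
    using fi by (intro integrable_mult_indicator[where 'b=real, simplified]) auto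
  have "(\<integral>\<omega>. g \<omega> \<partial>M) = (\<integral>\<omega>. (1 - \<delta>) * indicator A \<omega> - indicator A \<omega> * f \<omega> \<partial>M)"
    by (intro Bochner_Integration.integral_cong) (auto simp: g_def indicator_def)
  also have "\<dots> = (1 - \<delta>) * measure M A - (\<integral>\<omega>\<in>A. f \<omega> \<partial>M)"
    using fA by (subst Bochner_Integration.integral_diff) (auto simp: set_lebesgue_integral_def integrable_indicator_iff less_top[symmetric])
  finally have "(\<integral>\<omega>. g \<omega> \<partial>M) \<le> 0" using le by simp
  moreover have g0: "0 \<le> g \<omega>" for \<omega>
    by (auto simp: g_def indicator_def A_def)
  ultimately have "(\<integral>\<omega>. g \<omega> \<partial>M) = 0"
    by (meson Bochner_Integration.integral_nonneg order_antisym)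
  then have "AE \<omega> in M. g \<omega> = 0"
    using integral_nonneg_eq_0_iff_AE[OF gi] g0 by simp
  then show ?thesis
    using AE_space
  proof eventually_elim
    case (elim \<omega>)
    then have "\<omega> \<notin> A" by (auto simp: g_def A_def)
    then show ?case
      using elim(2) sub by (auto simp: A_def f_def subalgebra_def not_less)
  qed
qed

end

text \<open>The second summand, the mass on paths that have stayed below \<open>c\<close>, makes the
  inequality inductive: paths that cross at the next step take at least \<open>c\<close> times their
  probability out of it. With values in \<open>ennreal\<close> no integrability has to be
  maintained.\<close>

lemma ville_finite:
  fixes N :: "nat \<Rightarrow> 'w \<Rightarrow> ennreal"
  assumes sub: "\<And>n. subalgebra M (Filt n)"
    and mono: "\<And>m n. m \<le> n \<Longrightarrow> sets (Filt m) \<subseteq> sets (Filt n)"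
    and N: "\<And>n. N n \<in> borel_measurable (Filt n)"
    and super: "\<And>n B. B \<in> sets (Filt n) \<Longrightarrow>
      (\<integral>\<^sup>+\<omega>. indicator B \<omega> * N (Suc n) \<omega> \<partial>M) \<le> (\<integral>\<^sup>+\<omega>. indicator B \<omega> * N n \<omega> \<partial>M)"
    and A: "A \<in> sets (Filt 0)"
  shows "c * emeasure M {\<omega> \<in> A. \<exists>i\<le>n. c \<le> N i \<omega>} + (\<integral>\<^sup>+\<omega>. indicator {\<omega> \<in> A. \<forall>i\<le>n. N i \<omega> < c} \<omega> * N n \<omega> \<partial>M)
    \<le> (\<integral>\<^sup>+\<omega>. indicator A \<omega> * N 0 \<omega> \<partial>M)"
proof -
  have sp: "space (Filt n) = space M" for n using sub by (simp add: subalgebra_def)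
  have inM: "B \<in> sets M" if "B \<in> sets (Filt n)" for B n
    using that sub by (auto simp: subalgebra_def)
  have AF: "A \<in> sets (Filt n)" for n using A mono[of 0 n] by auto
  have Nn: "N i \<in> borel_measurable (Filt n)" if "i \<le> n" for i n
    by (rule measurable_from_subalg[OF _ N]) (use mono[OF that] sp in \<open>auto simp: subalgebra_def\<close>)
  have NM[measurable]: "N i \<in> borel_measurable M" for i
    by (rule measurable_from_subalg[OF sub N])
  have AM[measurable]: "A \<in> sets M" using inM[OF A] .
  have stay: "{\<omega> \<in> A. \<forall>i\<le>n. N i \<omega> < c} \<in> sets (Filt n)" for n
  proof -
    have "{\<omega> \<in> space (Filt n). \<forall>i\<in>{..n}. N i \<omega> < c} \<in> sets (Filt n)"
      using Nn by (intro sets.sets_Collect_finite_All) auto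
    then have "A \<inter> {\<omega> \<in> space (Filt n). \<forall>i\<in>{..n}. N i \<omega> < c} \<in> sets (Filt n)"
      using AF by blast
    moreover have "A \<inter> {\<omega> \<in> space (Filt n). \<forall>i\<in>{..n}. N i \<omega> < c} = {\<omega> \<in> A. \<forall>i\<le>n. N i \<omega> < c}"
      using sets.sets_into_space[OF AF] by auto
    ultimately show ?thesis
      by (rule back_subst[of "\<lambda>B. B \<in> sets (Filt n)"])
  qed
  have split: "c * emeasure M {\<omega> \<in> B. c \<le> N n \<omega>} + (\<integral>\<^sup>+\<omega>. indicator {\<omega> \<in> B. N n \<omega> < c} \<omega> * N n \<omega> \<partial>M)
      \<le> (\<integral>\<^sup>+\<omega>. indicator B \<omega> * N n \<omega> \<partial>M)" if B[measurable]: "B \<in> sets M" for B n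
  proof -
    have "c * emeasure M {\<omega> \<in> B. c \<le> N n \<omega>} + (\<integral>\<^sup>+\<omega>. indicator {\<omega> \<in> B. N n \<omega> < c} \<omega> * N n \<omega> \<partial>M)
      = (\<integral>\<^sup>+\<omega>. c * indicator {\<omega> \<in> B. c \<le> N n \<omega>} \<omega> \<partial>M) + (\<integral>\<^sup>+\<omega>. indicator {\<omega> \<in> B. N n \<omega> < c} \<omega> * N n \<omega> \<partial>M)"
      by (simp add: nn_integral_cmult_indicator)
    also have "\<dots> = (\<integral>\<^sup>+\<omega>. c * indicator {\<omega> \<in> B. c \<le> N n \<omega>} \<omega> + indicator {\<omega> \<in> B. N n \<omega> < c} \<omega> * N n \<omega> \<partial>M)"
      by (rule nn_integral_add[symmetric]) measurable
    also have "\<dots> \<le> (\<integral>\<^sup>+\<omega>. indicator B \<omega> * N n \<omega> \<partial>M)"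
      by (intro nn_integral_mono) (auto simp: indicator_def)
    finally show ?thesis .
  qed
  show ?thesis
  proof (induction n)
    case 0
    show ?case using split[OF AM, of 0] by simp
  next
    case (Suc n)
    define B where "B = {\<omega> \<in> A. \<forall>i\<le>n. N i \<omega> < c}"
    have B: "B \<in> sets (Filt n)" unfolding B_def by (rule stay)
    have BM[measurable]: "B \<in> sets M" by (rule inM[OF B])
    have eq1: "{\<omega> \<in> A. \<exists>i\<le>Suc n. c \<le> N i \<omega>} = {\<omega> \<in> A. \<exists>i\<le>n. c \<le> N i \<omega>} \<union> {\<omega> \<in> B. c \<le> N (Suc n) \<omega>}"
      unfolding B_def by (auto simp: le_Suc_eq not_le)
    have eq2: "{\<omega> \<in> A. \<forall>i\<le>Suc n. N i \<omega> < c} = {\<omega> \<in> B. N (Suc n) \<omega> < c}"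
      unfolding B_def by (auto simp: le_Suc_eq)
    have "{\<omega> \<in> A. \<exists>i\<le>n. c \<le> N i \<omega>} = A - B"
      unfolding B_def by (auto simp: not_le)
    then have m1: "{\<omega> \<in> A. \<exists>i\<le>n. c \<le> N i \<omega>} \<in> sets M" by simp
    have "c * emeasure M {\<omega> \<in> A. \<exists>i\<le>Suc n. c \<le> N i \<omega>} + (\<integral>\<^sup>+\<omega>. indicator {\<omega> \<in> A. \<forall>i\<le>Suc n. N i \<omega> < c} \<omega> * N (Suc n) \<omega> \<partial>M)
      \<le> c * (emeasure M {\<omega> \<in> A. \<exists>i\<le>n. c \<le> N i \<omega>} + emeasure M {\<omega> \<in> B. c \<le> N (Suc n) \<omega>})
        + (\<integral>\<^sup>+\<omega>. indicator {\<omega> \<in> B. N (Suc n) \<omega> < c} \<omega> * N (Suc n) \<omega> \<partial>M)"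
      unfolding eq1 eq2 using m1 by (intro add_mono mult_left_mono emeasure_subadditive) auto
    also have "\<dots> = c * emeasure M {\<omega> \<in> A. \<exists>i\<le>n. c \<le> N i \<omega>} + (c * emeasure M {\<omega> \<in> B. c \<le> N (Suc n) \<omega>}
        + (\<integral>\<^sup>+\<omega>. indicator {\<omega> \<in> B. N (Suc n) \<omega> < c} \<omega> * N (Suc n) \<omega> \<partial>M))"
      by (simp add: distrib_left add.assoc)
    also have "\<dots> \<le> c * emeasure M {\<omega> \<in> A. \<exists>i\<le>n. c \<le> N i \<omega>} + (\<integral>\<^sup>+\<omega>. indicator B \<omega> * N n \<omega> \<partial>M)"
      \<comment> \<open>\<open>B\<close> is decided at time \<open>n\<close>, so the supermartingale
        step is available on it after the crossing at \<open>Suc n\<close> has been split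
        off.\<close>
      by (intro add_left_mono order_trans[OF split[OF BM] super[OF B]])
    also have "\<dots> \<le> (\<integral>\<^sup>+\<omega>. indicator A \<omega> * N 0 \<omega> \<partial>M)"
      unfolding B_def by (rule Suc.IH)
    finally show ?case .
  qed
qed

lemma ville:
  fixes N :: "nat \<Rightarrow> 'w \<Rightarrow> ennreal"
  assumes sub: "\<And>n. subalgebra M (Filt n)"
    and mono: "\<And>m n. m \<le> n \<Longrightarrow> sets (Filt m) \<subseteq> sets (Filt n)"
    and N: "\<And>n. N n \<in> borel_measurable (Filt n)"
    and super: "\<And>n B. B \<in> sets (Filt n) \<Longrightarrow>
      (\<integral>\<^sup>+\<omega>. indicator B \<omega> * N (Suc n) \<omega> \<partial>M) \<le> (\<integral>\<^sup>+\<omega>. indicator B \<omega> * N n \<omega> \<partial>M)"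
    and A: "A \<in> sets (Filt 0)"
  shows "c * emeasure M {\<omega> \<in> A. \<exists>i. c \<le> N i \<omega>} \<le> (\<integral>\<^sup>+\<omega>. indicator A \<omega> * N 0 \<omega> \<partial>M)"
proof -
  have [measurable]: "N i \<in> borel_measurable M" for i
    by (rule measurable_from_subalg[OF sub N])
  have [measurable]: "A \<in> sets M" using A sub by (auto simp: subalgebra_def)
  let ?D = "\<lambda>n. {\<omega> \<in> A. \<exists>i\<le>n. c \<le> N i \<omega>}"
  have "{\<omega> \<in> A. \<exists>i. c \<le> N i \<omega>} = (\<Union>n. ?D n)" by auto
  moreover have "(SUP n. emeasure M (?D n)) = emeasure M (\<Union>n. ?D n)"
    by (rule SUP_emeasure_incseq) (auto simp: incseq_def intro: order_trans)
  ultimately have "c * emeasure M {\<omega> \<in> A. \<exists>i. c \<le> N i \<omega>} = (SUP n. c * emeasure M (?D n))"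
    by (metis SUP_mult_left_ennreal)
  also have "\<dots> \<le> (\<integral>\<^sup>+\<omega>. indicator A \<omega> * N 0 \<omega> \<partial>M)"
  proof (rule SUP_least)
    fix n
    have "c * emeasure M (?D n) \<le> c * emeasure M (?D n) + (\<integral>\<^sup>+\<omega>. indicator {\<omega> \<in> A. \<forall>i\<le>n. N i \<omega> < c} \<omega> * N n \<omega> \<partial>M)"
      by simp
    also have "\<dots> \<le> (\<integral>\<^sup>+\<omega>. indicator A \<omega> * N 0 \<omega> \<partial>M)"
      by (rule ville_finite[OF assms])
    finally show "c * emeasure M (?D n) \<le> (\<integral>\<^sup>+\<omega>. indicator A \<omega> * N 0 \<omega> \<partial>M)" .
  qed
  finally show ?thesis .
qed

section \<open>Measurability\<close>

lemma borel_measurable_vecI: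
  fixes f :: "'a \<Rightarrow> real^'n"
  assumes "\<And>i. (\<lambda>\<omega>. f \<omega> $ i) \<in> borel_measurable M"
  shows "f \<in> borel_measurable M"
  by (rule borel_measurable_euclidean_space[THEN iffD2])
    (auto simp: Basis_vec_def inner_axis assms)

lemma borel_measurable_vec_nth_comp:
  fixes f :: "'a \<Rightarrow> real^'n"
  assumes "f \<in> borel_measurable M"
  shows "(\<lambda>\<omega>. f \<omega> $ i) \<in> borel_measurable M"
  using measurable_compose[OF assms borel_measurable_nth[of i]] .

lemma borel_measurable_matrix_vector_mult:
  fixes A :: "'a \<Rightarrow> real^'n^'m"
  assumes "\<And>i j. (\<lambda>\<omega>. A \<omega> $ i $ j) \<in> borel_measurable M" and "x \<in> borel_measurable M"
  shows "(\<lambda>\<omega>. A \<omega> *v x \<omega>) \<in> borel_measurable M"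
proof (rule borel_measurable_vecI)
  fix i
  have "(\<lambda>\<omega>. \<Sum>j\<in>UNIV. A \<omega> $ i $ j * x \<omega> $ j) \<in> borel_measurable M"
    by (intro borel_measurable_sum borel_measurable_times assms borel_measurable_vec_nth_comp)
  then show "(\<lambda>\<omega>. (A \<omega> *v x \<omega>) $ i) \<in> borel_measurable M"
    by (simp add: matrix_vector_mult_def)
qed

lemma borel_measurable_matrix_matrix_mult:
  fixes A :: "'a \<Rightarrow> real^'n^'m" and B :: "'a \<Rightarrow> real^'k^'n"
  assumes "\<And>i j. (\<lambda>\<omega>. A \<omega> $ i $ j) \<in> borel_measurable M" and "\<And>i j. (\<lambda>\<omega>. B \<omega> $ i $ j) \<in> borel_measurable M"
  shows "(\<lambda>\<omega>. (A \<omega> ** B \<omega>) $ i $ j) \<in> borel_measurable M"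
proof -
  have "(\<lambda>\<omega>. \<Sum>l\<in>UNIV. A \<omega> $ i $ l * B \<omega> $ l $ j) \<in> borel_measurable M"
    by (intro borel_measurable_sum borel_measurable_times assms)
  then show ?thesis by (simp add: matrix_matrix_mult_def)
qed

lemma borel_measurable_phi: "phi \<in> borel_measurable borel"
proof (rule borel_measurable_vecI)
  fix i :: 2
  show "(\<lambda>x. phi x $ i) \<in> borel_measurable borel"
    using exhaust_2[of i] by (auto simp: phi_def)
qed

lemma borel_measurable_grad:
  assumes "C3_field F"
  shows "grad F \<in> borel_measurable borel"
proof (rule borel_measurable_vecI)
  fix i
  have d: "F differentiable_on UNIV" "fderiv F differentiable_on UNIV"
    using assms by (auto simp: C3_field_def)
  have "continuous_on UNIV (\<lambda>x. fderiv F x (axis i 1))"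
    by (intro continuous_intros differentiable_imp_continuous_on d)
  moreover have "fderiv F x (axis i 1) = grad F x $ i" for x
    by (simp add: fderiv_eq_grad[OF d(1)] inner_axis)
  ultimately show "(\<lambda>x. grad F x $ i) \<in> borel_measurable borel"
    by (simp add: borel_measurable_continuous_onI)
qed

lemma borel_measurable_psi:
  assumes "(\<lambda>\<omega>. a \<omega> 1) \<in> borel_measurable M" and "(\<lambda>\<omega>. a \<omega> i) \<in> borel_measurable M"
  shows "(\<lambda>\<omega>. psi (a \<omega>) i) \<in> borel_measurable M"
proof (rule borel_measurable_vecI)
  fix r :: 5
  note [measurable] = assms
  have "psi (a \<omega>) i $ r = (if r = 1 then 1 else if i = 1 then 0
      else if r = 2 then cos (a \<omega> i) - cos (a \<omega> 1) else if r = 3 then sin (a \<omega> i) - sin (a \<omega> 1)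
      else if r = 4 then cos (2 * a \<omega> i) - cos (2 * a \<omega> 1) else sin (2 * a \<omega> i) - sin (2 * a \<omega> 1))" for \<omega>
    using exhaust_5[of r] by (auto simp: psi_def vector_5 vector_4 zvec_def Let_def)
  then show "(\<lambda>\<omega>. psi (a \<omega>) i $ r) \<in> borel_measurable M"
    by (simp only:) measurable
qed

lemma borel_measurable_Vmat:
  assumes "\<And>i. 1 \<le> i \<Longrightarrow> i \<le> n \<Longrightarrow> (\<lambda>\<omega>. a \<omega> i) \<in> borel_measurable M"
  shows "(\<lambda>\<omega>. Vmat lam (a \<omega>) n $ r $ c) \<in> borel_measurable M"
proof -
  have psi: "(\<lambda>\<omega>. psi (a \<omega>) i $ r) \<in> borel_measurable M" if "i \<in> {1..n}" for i r
    using that by (intro borel_measurable_vec_nth_comp borel_measurable_psi assms) auto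
  have "(\<lambda>\<omega>. Lambda lam $ r $ c + (\<Sum>i=1..n. psi (a \<omega>) i $ r * psi (a \<omega>) i $ c)) \<in> borel_measurable M"
    by (intro borel_measurable_add borel_measurable_const borel_measurable_sum borel_measurable_times psi)
  then show ?thesis
    by (simp add: Vmat_def)
qed

section \<open>The information generated by a scan\<close>

lemma info_gen_subset:
  assumes "subalgebra M H"
  shows "sets H
      \<union> {{\<omega> \<in> space M. enat i \<le> \<tau> j \<omega> \<and> (\<alpha> j i \<omega>, y j i \<omega>) \<in> A} | j i A.
           j < k \<and> 1 \<le> i \<and> A \<in> sets borel}
      \<union> {{\<omega> \<in> space M. (\<alpha> k i \<omega>, y k i \<omega>) \<in> A} | i A.
           1 \<le> i \<and> i \<le> n \<and> A \<in> sets borel} \<subseteq> Pow (space M)"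
  using assms sets.sets_into_space[of _ H] by (auto simp: subalgebra_def)

lemma space_info [simp]: "space (info M H \<tau> \<alpha> y k n) = space M"
  unfolding info_def by (rule space_measure_of_conv)

lemma sets_info:
  assumes "subalgebra M H"
  shows "sets (info M H \<tau> \<alpha> y k n) = sigma_sets (space M) (sets H
      \<union> {{\<omega> \<in> space M. enat i \<le> \<tau> j \<omega> \<and> (\<alpha> j i \<omega>, y j i \<omega>) \<in> A} | j i A.
           j < k \<and> 1 \<le> i \<and> A \<in> sets borel}
      \<union> {{\<omega> \<in> space M. (\<alpha> k i \<omega>, y k i \<omega>) \<in> A} | i A.
           1 \<le> i \<and> i \<le> n \<and> A \<in> sets borel})"
  unfolding info_def by (rule sets_measure_of[OF info_gen_subset[OF assms]])

lemma sets_info_mono: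
  assumes "subalgebra M H" "m \<le> n"
  shows "sets (info M H \<tau> \<alpha> y k m) \<subseteq> sets (info M H \<tau> \<alpha> y k n)"
  unfolding sets_info[OF assms(1)]
proof (intro sigma_sets_mono' Un_mono subset_refl)
  show "{{\<omega> \<in> space M. (\<alpha> k i \<omega>, y k i \<omega>) \<in> A} | i A. 1 \<le> i \<and> i \<le> m \<and> A \<in> sets borel}
    \<subseteq> {{\<omega> \<in> space M. (\<alpha> k i \<omega>, y k i \<omega>) \<in> A} | i A. 1 \<le> i \<and> i \<le> n \<and> A \<in> sets borel}"
    using assms(2) by (blast intro: order_trans)
qed

lemma measurable_info_mono:
  assumes "subalgebra M H" "m \<le> n" "f \<in> measurable (info M H \<tau> \<alpha> y k m) N"
  shows "f \<in> measurable (info M H \<tau> \<alpha> y k n) N"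
  by (rule measurable_from_subalg[OF _ assms(3)])
    (use sets_info_mono[OF assms(1,2)] in \<open>auto simp: subalgebra_def\<close>)

lemma measurable_info_observation:
  assumes "subalgebra M H" "1 \<le> i" "i \<le> n"
  shows "\<alpha> k i \<in> borel_measurable (info M H \<tau> \<alpha> y k n)"
    and "y k i \<in> borel_measurable (info M H \<tau> \<alpha> y k n)"
proof -
  have pair: "(\<lambda>\<omega>. (\<alpha> k i \<omega>, y k i \<omega>)) \<in> borel_measurable (info M H \<tau> \<alpha> y k n)"
  proof (rule measurableI)
    fix A :: "(real \<times> real) set" assume "A \<in> sets borel"
    then have "{\<omega> \<in> space M. (\<alpha> k i \<omega>, y k i \<omega>) \<in> A} \<in> sets (info M H \<tau> \<alpha> y k n)"
      unfolding sets_info[OF assms(1)] using assms(2,3) by (intro sigma_sets.Basic) blast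
    then show "(\<lambda>\<omega>. (\<alpha> k i \<omega>, y k i \<omega>)) -` A \<inter> space (info M H \<tau> \<alpha> y k n) \<in> sets (info M H \<tau> \<alpha> y k n)"
      by (simp add: vimage_def Int_def conj_commute)
  qed simp
  show "\<alpha> k i \<in> borel_measurable (info M H \<tau> \<alpha> y k n)" "y k i \<in> borel_measurable (info M H \<tau> \<alpha> y k n)"
    using borel_measurable_continuous_on[OF continuous_on_fst[OF continuous_on_id] pair]
      borel_measurable_continuous_on[OF continuous_on_snd[OF continuous_on_id] pair]
    by simp_all
qed

text \<open>The generators of \<open>info\<close> are not known beforehand to be events of
  \<open>M\<close>, since bearings are only tied to the information generated before them.
  Measurability is thus a premise here, to be supplied by induction over episodes and
  samples.\<close>

lemma subalgebra_info:
  assumes H: "subalgebra M H"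
    and past: "\<And>j i. j < k \<Longrightarrow> 1 \<le> i \<Longrightarrow> \<alpha> j i \<in> borel_measurable M"
      "\<And>j i. j < k \<Longrightarrow> 1 \<le> i \<Longrightarrow> y j i \<in> borel_measurable M"
      "\<And>j i. j < k \<Longrightarrow> 1 \<le> i \<Longrightarrow> {\<omega> \<in> space M. enat i \<le> \<tau> j \<omega>} \<in> sets M"
    and now: "\<And>i. 1 \<le> i \<Longrightarrow> i \<le> n \<Longrightarrow> \<alpha> k i \<in> borel_measurable M"
      "\<And>i. 1 \<le> i \<Longrightarrow> i \<le> n \<Longrightarrow> y k i \<in> borel_measurable M"
  shows "subalgebra M (info M H \<tau> \<alpha> y k n)"
proof -
  have obs: "{\<omega> \<in> space M. (\<alpha> j i \<omega>, y j i \<omega>) \<in> A} \<in> sets M"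
    if "\<alpha> j i \<in> borel_measurable M" "y j i \<in> borel_measurable M" "A \<in> sets borel" for j i and A :: "(real \<times> real) set"
    using measurable_sets[OF borel_measurable_Pair[OF that(1,2)] that(3)]
    by (simp add: vimage_def Int_def conj_commute)
  have "{\<omega> \<in> space M. enat i \<le> \<tau> j \<omega> \<and> (\<alpha> j i \<omega>, y j i \<omega>) \<in> A} \<in> sets M"
    if "j < k" "1 \<le> i" "A \<in> sets borel" for j i and A :: "(real \<times> real) set"
    using sets.Int[OF past(3)[OF that(1,2)] obs[OF past(1,2)[OF that(1,2)] that(3)]]
    by (simp add: Int_def conj_ac cong: conj_cong)
  then have "sets (info M H \<tau> \<alpha> y k n) \<subseteq> sets M"
    unfolding sets_info[OF H] using H now obs by (intro sets.sigma_sets_subset) (auto simp: subalgebra_def)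
  then show ?thesis by (simp add: subalgebra_def)
qed

section \<open>The scan-and-move model\<close>

text \<open>The episode is not fixed, because measurability in one episode depends on all earlier
  ones.\<close>

locale scan_model =
  fixes M H :: "'w measure"
    and F :: "real^2 \<Rightarrow> real" and pstar :: "real^2" and G L M3 \<Delta>0 \<rho> \<sigma> lam \<delta> :: real
    and p :: "nat \<Rightarrow> 'w \<Rightarrow> real^2" and \<theta> :: "nat \<Rightarrow> 'w \<Rightarrow> real"
    and \<alpha> w y :: "nat \<Rightarrow> nat \<Rightarrow> 'w \<Rightarrow> real" and \<tau> :: "nat \<Rightarrow> 'w \<Rightarrow> enat"
  assumes M: "prob_space M" and H: "subalgebra M H"
    and field: "\<And>\<omega>. \<omega> \<in> space M \<Longrightarrow> field_assumption F (p 0 \<omega>) pstar G L M3 \<Delta>0"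
    and pos: "0 < \<rho>" "0 \<le> \<sigma>" "0 < lam" "0 < \<delta>" "\<delta> < 1"
    and measurement: "\<And>j i \<omega>. 1 \<le> i \<Longrightarrow> \<omega> \<in> space M \<Longrightarrow>
           y j i \<omega> = F (p j \<omega> + \<rho> *\<^sub>R phi (\<theta> j \<omega> + \<alpha> j i \<omega>)) + w j i \<omega>"
    and scan_length: "\<And>j. scan_stopping_time (info M H \<tau> \<alpha> y j) (\<tau> j)"
    and position: "\<And>j. p j \<in> borel_measurable (info M H \<tau> \<alpha> y j 0)"
    and heading: "\<And>j. \<theta> j \<in> borel_measurable (info M H \<tau> \<alpha> y j 0)"
    and bearing: "\<And>j i. 1 \<le> i \<Longrightarrow> \<alpha> j i \<in> borel_measurable (info M H \<tau> \<alpha> y j (i - 1))"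
    and noise_measurable: "\<And>j i. 1 \<le> i \<Longrightarrow> w j i \<in> borel_measurable M"
    and noise_subgaussian: "\<And>j i s. 1 \<le> i \<Longrightarrow>
           AE \<omega> in M. nn_cond_exp M (info M H \<tau> \<alpha> y j (i - 1)) (\<lambda>\<omega>. ennreal (exp (s * w j i \<omega>))) \<omega>
             \<le> ennreal (exp (s^2 * \<sigma>^2 / 2))"
begin

abbreviation Filt :: "nat \<Rightarrow> nat \<Rightarrow> 'w measure" where
  "Filt \<equiv> info M H \<tau> \<alpha> y"

text \<open>The initial position may be random, so the field assumption is indexed by outcomes; the
  regularity of \<open>F\<close> can be taken from any single one.\<close>

lemma field_fixed: obtains p0 where "field_assumption F p0 pstar G L M3 \<Delta>0"
  using field prob_space.not_empty[OF M] by blast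

lemma C3: "C3_field F"
  using field_fixed by (metis field_assumption_def)

lemma measurable_F_at_sensor:
  assumes "p j \<in> borel_measurable N" "\<theta> j \<in> borel_measurable N" "\<alpha> j i \<in> borel_measurable N"
  shows "(\<lambda>\<omega>. F (p j \<omega> + \<rho> *\<^sub>R phi (\<theta> j \<omega> + \<alpha> j i \<omega>))) \<in> borel_measurable N"
proof -
  have F: "F \<in> borel_measurable borel"
    using C3 by (intro borel_measurable_continuous_onI differentiable_imp_continuous_on) (simp add: C3_field_def)
  note [measurable] = F borel_measurable_phi assms
  show ?thesis by measurable
qed

text \<open>That sample \<open>i\<close> is recorded is the complement of stopping by
  \<open>i - 1\<close>, so it is decided one sample earlier.\<close>

lemma scan_length_event:
  assumes sub: "subalgebra M (Filt j m)" and i: "i = Suc m"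
  shows "{\<omega> \<in> space M. enat i \<le> \<tau> j \<omega>} \<in> sets M"
proof -
  have "{\<omega> \<in> space (Filt j m). \<tau> j \<omega> \<le> enat m} \<in> sets (Filt j m)"
    using scan_length[of j] unfolding scan_stopping_time_def pred_def by blast
  then have "{\<omega> \<in> space M. \<tau> j \<omega> \<le> enat m} \<in> sets M"
    using sub by (auto simp: subalgebra_def)
  then have "space M - {\<omega> \<in> space M. \<tau> j \<omega> \<le> enat m} \<in> sets M"
    by (rule sets.compl_sets)
  also have "space M - {\<omega> \<in> space M. \<tau> j \<omega> \<le> enat m} = {\<omega> \<in> space M. enat i \<le> \<tau> j \<omega>}"
    by (auto simp: i Suc_ile_eq not_le)
  finally show ?thesis .
qed

text \<open>Two nested inductions are forced: a bearing is measurable for \<open>M\<close> only once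
  the information before it is a subalgebra, and that requires the earlier measurements; the
  measurement itself then follows from the sensing equation.\<close>

lemma episode_measurable:
  "(\<forall>i\<ge>1. \<alpha> j i \<in> borel_measurable M \<and> y j i \<in> borel_measurable M) \<and> (\<forall>n. subalgebra M (Filt j n))"
proof (induction j rule: less_induct)
  case (less j)
  have past: "\<alpha> j' i \<in> borel_measurable M" "y j' i \<in> borel_measurable M"
      "{\<omega> \<in> space M. enat i \<le> \<tau> j' \<omega>} \<in> sets M"
    if "j' < j" "1 \<le> i" for j' i
    using less.IH[OF that(1)] that(2) scan_length_event[of j' "i - 1" i] by auto
  have obs: "\<forall>i. 1 \<le> i \<and> i \<le> n \<longrightarrow> \<alpha> j i \<in> borel_measurable M \<and> y j i \<in> borel_measurable M" for n
  proof (induction n)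
    case (Suc n)
    have sub: "subalgebra M (Filt j m)" if "m \<le> n" for m
      by (rule subalgebra_info[OF H past]) (use Suc.IH that in auto)
    let ?i = "Suc n"
    have a: "\<alpha> j ?i \<in> borel_measurable M"
      using measurable_from_subalg[OF sub[OF order_refl] bearing[of ?i j, unfolded diff_Suc_1]] by simp
    have "(\<lambda>\<omega>. F (p j \<omega> + \<rho> *\<^sub>R phi (\<theta> j \<omega> + \<alpha> j ?i \<omega>)) + w j ?i \<omega>) \<in> borel_measurable M"
      by (intro borel_measurable_add measurable_F_at_sensor a noise_measurable
          measurable_from_subalg[OF sub[of 0] position] measurable_from_subalg[OF sub[of 0] heading]) simp_all
    then have "y j ?i \<in> borel_measurable M"
      by (rule measurable_cong[THEN iffD1, rotated]) (simp add: measurement)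
    with a Suc.IH show ?case by (auto simp: le_Suc_eq)
  qed simp
  moreover have "subalgebra M (Filt j n)" for n
    by (rule subalgebra_info[OF H past]) (use obs[of n] in auto)
  ultimately show ?case by blast
qed

lemma subalgebra_Filt: "subalgebra M (Filt j n)"
  using episode_measurable by blast

lemma measurable_M_observation: "1 \<le> i \<Longrightarrow> y j i \<in> borel_measurable M"
  using episode_measurable by blast

lemma noise_given: "1 \<le> i \<Longrightarrow> subgaussian_given M (Filt k (i - 1)) \<sigma> (w k i)"
  unfolding subgaussian_given_def using noise_subgaussian[of i k] noise_measurable[of i k] by blast

text \<open>The bound \<open>Suc n\<close> expresses predictability: a bearing is chosen before its
  measurement. So the next regressor and the next matrix are already known when the next noise value
  arrives.\<close>

lemma bearing_Filt: "1 \<le> i \<Longrightarrow> i \<le> Suc n \<Longrightarrow> \<alpha> k i \<in> borel_measurable (Filt k n)"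
  by (rule measurable_info_mono[OF H, of "i - 1"], simp, rule bearing)

text \<open>The noise is not observed, but it is the measurement minus the field at a known sensor
  position, so it is adapted to the observed information.\<close>

lemma noise_Filt:
  assumes "1 \<le> i" "i \<le> n"
  shows "w k i \<in> borel_measurable (Filt k n)"
proof -
  have "(\<lambda>\<omega>. y k i \<omega> - F (p k \<omega> + \<rho> *\<^sub>R phi (\<theta> k \<omega> + \<alpha> k i \<omega>))) \<in> borel_measurable (Filt k n)"
    by (rule borel_measurable_diff[OF measurable_info_observation(2)[OF H assms]
          measurable_F_at_sensor[OF measurable_info_mono[OF H le0 position]
            measurable_info_mono[OF H le0 heading] measurable_info_observation(1)[OF H assms]]])
  then show ?thesis
    by (rule measurable_cong[THEN iffD1, rotated]) (simp add: measurement[OF assms(1)])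
qed

lemma Vmat_Filt: "n \<le> Suc m \<Longrightarrow> (\<lambda>\<omega>. Vmat lam (\<lambda>i. \<alpha> k i \<omega>) n $ r $ c) \<in> borel_measurable (Filt k m)"
  by (intro borel_measurable_Vmat bearing_Filt) auto

lemma psi_Filt: "1 \<le> n \<Longrightarrow> n \<le> Suc m \<Longrightarrow> (\<lambda>\<omega>. psi (\<lambda>i. \<alpha> k i \<omega>) n) \<in> borel_measurable (Filt k m)"
  by (intro borel_measurable_psi bearing_Filt) auto

lemma Vmat_inv_Filt:
  "1 \<le> n \<Longrightarrow> n \<le> Suc m \<Longrightarrow> (\<lambda>\<omega>. matrix_inv (Vmat lam (\<lambda>i. \<alpha> k i \<omega>) n) $ r $ c) \<in> borel_measurable (Filt k m)"
  by (intro borel_measurable_matrix_inv Vmat_Filt posdef_invertible posdef_Vmat pos)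

lemma noise_sum_Filt: "n \<le> m \<Longrightarrow> (\<lambda>\<omega>. noise_sum (\<lambda>i. \<alpha> k i \<omega>) (\<lambda>i. w k i \<omega>) n) \<in> borel_measurable (Filt k m)"
  unfolding noise_sum_def by (intro borel_measurable_sum borel_measurable_scaleR noise_Filt psi_Filt) auto

lemma noise_quad_Filt:
  "1 \<le> n \<Longrightarrow> n \<le> m \<Longrightarrow> (\<lambda>\<omega>. noise_quad lam (\<lambda>i. \<alpha> k i \<omega>) (\<lambda>i. w k i \<omega>) n) \<in> borel_measurable (Filt k m)"
  unfolding noise_quad_def
  by (intro borel_measurable_inner borel_measurable_matrix_vector_mult Vmat_inv_Filt noise_sum_Filt) auto

lemma mixture_Filt:
  "1 \<le> n \<Longrightarrow> n \<le> m \<Longrightarrow> (\<lambda>\<omega>. mixture \<sigma> lam (\<lambda>i. \<alpha> k i \<omega>) (\<lambda>i. w k i \<omega>) n) \<in> borel_measurable (Filt k m)"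
  unfolding mixture_def
  by (intro borel_measurable_times measurable_compose[OF _ borel_measurable_exp] borel_measurable_divide noise_quad_Filt
      borel_measurable_const measurable_compose[OF _ borel_measurable_sqrt] borel_measurable_det Vmat_Filt) auto

text \<open>The indicator of \<open>B\<close> and the current value form the weight of
  \<open>subgaussian_mixture\<close>; its mean and variance are predictable because they involve the
  new bearing but not the new noise.\<close>

lemma mixture_supermartingale:
  assumes "0 < \<sigma>" "1 \<le> n" and B: "B \<in> sets (Filt k n)"
  shows "(\<integral>\<^sup>+\<omega>. indicator B \<omega> * ennreal (mixture \<sigma> lam (\<lambda>i. \<alpha> k i \<omega>) (\<lambda>i. w k i \<omega>) (Suc n)) \<partial>M)
    \<le> (\<integral>\<^sup>+\<omega>. indicator B \<omega> * ennreal (mixture \<sigma> lam (\<lambda>i. \<alpha> k i \<omega>) (\<lambda>i. w k i \<omega>) n) \<partial>M)"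
proof -
  let ?a = "\<lambda>\<omega> i. \<alpha> k i \<omega>" and ?w = "\<lambda>\<omega> i. w k i \<omega>"
  define c where "c \<omega> = psi (?a \<omega>) (Suc n) \<bullet> (matrix_inv (Vmat lam (?a \<omega>) n) *v psi (?a \<omega>) (Suc n))" for \<omega>
  define m where "m \<omega> = (psi (?a \<omega>) (Suc n) \<bullet> (matrix_inv (Vmat lam (?a \<omega>) n) *v noise_sum (?a \<omega>) (?w \<omega>) n)) / \<sigma>" for \<omega>
  define x where "x \<omega> = w k (Suc n) \<omega> / \<sigma>" for \<omega>
  define Z where "Z \<omega> = indicator B \<omega> * ennreal (mixture \<sigma> lam (?a \<omega>) (?w \<omega>) n)" for \<omega>
  have c0: "0 \<le> c \<omega>" for \<omega>
    unfolding c_def by (rule posdef_nonneg[OF posdef_matrix_inv[OF posdef_Vmat[OF pos(3) assms(2)]]])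
  have mix0: "0 \<le> mixture \<sigma> lam (?a \<omega>) (?w \<omega>) n" for \<omega>
    using det_Vmat_mono[OF pos(3) assms(2), of "?a \<omega>"] by (simp add: mixture_def)
  have "(\<integral>\<^sup>+\<omega>. indicator B \<omega> * ennreal (mixture \<sigma> lam (?a \<omega>) (?w \<omega>) (Suc n)) \<partial>M)
    = (\<integral>\<^sup>+\<omega>. Z \<omega> * ennreal (exp ((c \<omega> * (x \<omega>)\<^sup>2 + 2 * m \<omega> * x \<omega> - (m \<omega>)\<^sup>2) / (2 * (1 + c \<omega>))) / sqrt (1 + c \<omega>)) \<partial>M)"
    unfolding mixture_Suc[OF pos(3) assms(2,1)] c_def[symmetric] m_def[symmetric] x_def[symmetric] Z_def
    by (simp only: ennreal_mult' mix0 mult.assoc)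
  also have "\<dots> \<le> (\<integral>\<^sup>+\<omega>. Z \<omega> \<partial>M)"
  proof (rule subgaussian_mixture[OF M subalgebra_Filt])
    show "subgaussian_given M (Filt k n) 1 x"
      using subgaussian_given_scale[OF noise_given[of "Suc n" k] assms(1)] by (simp add: x_def[abs_def])
    show "Z \<in> borel_measurable (Filt k n)"
      unfolding Z_def
      by (intro borel_measurable_times_ennreal borel_measurable_indicator B measurable_compose[OF mixture_Filt measurable_ennreal])
        (use assms in auto)
    show "m \<in> borel_measurable (Filt k n)"
      unfolding m_def
      by (intro borel_measurable_divide borel_measurable_inner borel_measurable_matrix_vector_mult
          Vmat_inv_Filt noise_sum_Filt psi_Filt borel_measurable_const) (use assms in auto)
    show "c \<in> borel_measurable (Filt k n)"
      unfolding c_def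
      by (intro borel_measurable_inner borel_measurable_matrix_vector_mult Vmat_inv_Filt psi_Filt) (use assms in auto)
  qed (rule c0)
  finally show ?thesis by (simp add: Z_def)
qed

lemma mixture_maximal:
  assumes "0 < \<sigma>" and A: "A \<in> sets (Filt k 0)"
  shows "emeasure M {\<omega> \<in> A. \<exists>n\<ge>1. 2 / \<delta> \<le> mixture \<sigma> lam (\<lambda>i. \<alpha> k i \<omega>) (\<lambda>i. w k i \<omega>) n}
    \<le> ennreal (\<delta> / 2) * emeasure M A"
proof -
  let ?N = "\<lambda>n \<omega>. ennreal (mixture \<sigma> lam (\<lambda>i. \<alpha> k i \<omega>) (\<lambda>i. w k i \<omega>) (Suc n))"
  let ?D = "{\<omega> \<in> A. \<exists>n. ennreal (2 / \<delta>) \<le> ?N n \<omega>}"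
  have AM: "A \<in> sets M" using A subalgebra_Filt[of k 0] by (auto simp: subalgebra_def)
  have A1: "A \<in> sets (Filt k (Suc 0))" using subsetD[OF sets_info_mono[OF H le0] A] .
  have "ennreal (2 / \<delta>) * emeasure M ?D \<le> (\<integral>\<^sup>+\<omega>. indicator A \<omega> * ?N 0 \<omega> \<partial>M)"
  \<comment> \<open>Time \<open>n\<close> in Ville's inequality is sample \<open>Suc n\<close>: the
    process equals 1 at sample 1, so its initial integral over \<open>A\<close> is the measure of
    \<open>A\<close>.\<close>
  proof (rule ville[where Filt = "\<lambda>n. Filt k (Suc n)"])
    show "?N n \<in> borel_measurable (Filt k (Suc n))" for n
      by (intro measurable_compose[OF mixture_Filt measurable_ennreal]) auto
    show "(\<integral>\<^sup>+\<omega>. indicator B \<omega> * ?N (Suc n) \<omega> \<partial>M) \<le> (\<integral>\<^sup>+\<omega>. indicator B \<omega> * ?N n \<omega> \<partial>M)"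
      if "B \<in> sets (Filt k (Suc n))" for n B
      by (rule mixture_supermartingale[OF assms(1) _ that]) simp
  qed (use subalgebra_Filt sets_info_mono[OF H] A1 in auto)
  also have "\<dots> = emeasure M A"
    using mixture_1[OF pos(3)] AM by (simp flip: One_nat_def)
  finally have "ennreal (\<delta> / 2) * (ennreal (2 / \<delta>) * emeasure M ?D) \<le> ennreal (\<delta> / 2) * emeasure M A"
    by (rule mult_left_mono) simp
  then have "emeasure M ?D \<le> ennreal (\<delta> / 2) * emeasure M A"
    using pos(4) by (simp add: mult.assoc[symmetric] ennreal_mult[symmetric])
  moreover have "{\<omega> \<in> A. \<exists>n\<ge>1. 2 / \<delta> \<le> mixture \<sigma> lam (\<lambda>i. \<alpha> k i \<omega>) (\<lambda>i. w k i \<omega>) n} = ?D"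
  proof -
    have "(\<exists>n\<ge>1. Q n) \<longleftrightarrow> (\<exists>n. Q (Suc n))" for Q
      by (metis Suc_le_D One_nat_def Suc_le_mono zero_le)
    \<comment> \<open>\<open>ennreal\<close> truncates negative reals to zero, which does not affect
      a comparison with a positive threshold.\<close>
    moreover have "ennreal (2 / \<delta>) \<le> ennreal x \<longleftrightarrow> 2 / \<delta> \<le> x" for x
    proof -
      have "0 < 2 / \<delta>" using pos(4) by simp
      then show ?thesis unfolding ennreal_le_iff2 by linarith
    qed
    ultimately show ?thesis by simp
  qed
  ultimately show ?thesis by simp
qed

section \<open>The coverage event and its probability\<close>

definition covered :: "nat \<Rightarrow> nat \<Rightarrow> 'w \<Rightarrow> bool" where
  "covered k n \<omega> \<longleftrightarrow> local_grad F (p k \<omega>) (\<theta> k \<omega>)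
        \<in> conf_set \<rho> lam \<sigma> G L M3 \<delta> (\<lambda>i. \<alpha> k i \<omega>) (\<lambda>i. y k i \<omega>) n"

lemma covered_measurable:
  assumes "1 \<le> n"
  shows "{\<omega> \<in> space M. covered k n \<omega>} \<in> sets M"
proof -
  let ?a = "\<lambda>\<omega> i. \<alpha> k i \<omega>" and ?y = "\<lambda>\<omega> i. y k i \<omega>"
  note toM = measurable_from_subalg[OF subalgebra_Filt]
  have V: "(\<lambda>\<omega>. Vmat lam (?a \<omega>) n $ r $ c) \<in> borel_measurable M" for n r c
    by (rule toM[OF Vmat_Filt[OF le_SucI[OF order_refl]]])
  have Vi: "(\<lambda>\<omega>. matrix_inv (Vmat lam (?a \<omega>) n) $ r $ c) \<in> borel_measurable M" for r c
    by (rule toM[OF Vmat_inv_Filt[OF assms le_SucI[OF order_refl]]])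
  have Pi: "(\<lambda>\<omega>. matrix_inv (Pmat \<rho> lam (?a \<omega>) n) $ r $ c) \<in> borel_measurable M" for r c
    unfolding Pmat_def
    by (intro borel_measurable_matrix_inv borel_measurable_matrix_matrix_mult borel_measurable_const Vi
        posdef_invertible[OF posdef_Pmat[unfolded Pmat_def]] pos assms)
  have y: "(\<lambda>\<omega>. y k i \<omega>) \<in> borel_measurable M" if "1 \<le> i" for i
    using measurable_M_observation[OF that] by simp
  have gh: "(\<lambda>\<omega>. ghat \<rho> lam (?a \<omega>) (?y \<omega>) n) \<in> borel_measurable M"
    unfolding ghat_def est_def
    by (intro borel_measurable_matrix_vector_mult Vi borel_measurable_const borel_measurable_sum
        borel_measurable_scaleR y toM[OF psi_Filt[OF _ le_SucI[OF order_refl]]]) auto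
  have g: "(\<lambda>\<omega>. local_grad F (p k \<omega>) (\<theta> k \<omega>)) \<in> borel_measurable M"
    unfolding local_grad_def
  proof (intro borel_measurable_matrix_vector_mult measurable_compose[OF toM[OF position] borel_measurable_grad[OF C3]])
    fix i j :: 2
    note [measurable] = toM[OF heading[of k]]
    show "(\<lambda>\<omega>. transpose (rotation (\<theta> k \<omega>)) $ i $ j) \<in> borel_measurable M"
      using exhaust_2[of i] exhaust_2[of j] by (auto simp: transpose_def rotation_def)
  qed
  have det: "(\<lambda>\<omega>. det (Vmat lam (?a \<omega>) n)) \<in> borel_measurable M" for n
    by (rule borel_measurable_det[OF V])
  have r: "(\<lambda>\<omega>. radius \<rho> lam \<sigma> G L M3 \<delta> (?a \<omega>) n) \<in> borel_measurable M"
    unfolding radius_def using det[of n] det[of 1] by measurable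
  show ?thesis
    unfolding covered_def conf_set_def mem_Collect_eq
    by (intro borel_measurable_le borel_measurable_power r borel_measurable_inner borel_measurable_diff
        borel_measurable_matrix_vector_mult g gh Pi)
qed

lemma covered_of_noise:
  assumes "\<omega> \<in> space M" "1 \<le> n"
    and "\<bar>w k 1 \<omega>\<bar> \<le> \<sigma> * sqrt (2 * ln (4 / \<delta>))"
    and "noise_quad lam (\<lambda>i. \<alpha> k i \<omega>) (\<lambda>i. w k i \<omega>) n \<le> 2 * \<sigma>\<^sup>2 * ln (2 * sqrt (det (Vmat lam (\<lambda>i. \<alpha> k i \<omega>) n)) / (\<delta> * sqrt (det (Vmat lam (\<lambda>i. \<alpha> k i \<omega>) 1))))"
  shows "covered k n \<omega>"
  unfolding covered_def
  by (rule gradient_covered_of_noise[OF field[OF assms(1)] pos assms(2) measurement[OF _ assms(1)] assms(3,4)])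

lemma covered_event: "{\<omega> \<in> space M. \<forall>n\<ge>1. covered k n \<omega>} \<in> sets M"
proof -
  have "{\<omega> \<in> space M. 1 \<le> n \<longrightarrow> covered k n \<omega>} \<in> sets M" for n
    using covered_measurable[of n k] by (cases "1 \<le> n") simp_all
  then show ?thesis by (rule sets.sets_Collect_countable_All)
qed

text \<open>Normalising the noise needs a positive \<sigma>. For \<sigma> zero the noise vanishes
  almost surely, so coverage is almost sure; otherwise a failure lies in one of two exceptional
  events, each with half of the budget.\<close>

lemma not_covered_emeasure_le:
  assumes A: "A \<in> sets (Filt k 0)"
  shows "emeasure M (A - {\<omega> \<in> space M. \<forall>n\<ge>1. covered k n \<omega>}) \<le> ennreal \<delta> * emeasure M A"
proof (cases "\<sigma> = 0")
  case True
  have AM: "A \<in> sets M" using A subalgebra_Filt[of k 0] by (auto simp: subalgebra_def)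
  have "AE \<omega> in M. w k i \<omega> = 0" if "1 \<le> i" for i
    by (rule subgaussian_zero[OF M subalgebra_Filt noise_given[OF that, unfolded True]])
  then have zero: "AE \<omega> in M. \<forall>i\<ge>1. w k i \<omega> = 0"
    unfolding AE_all_countable by simp
  have "AE \<omega> in M. \<forall>n\<ge>1. covered k n \<omega>"
    using zero AE_space
  proof eventually_elim
    case (elim \<omega>)
    then have "noise_sum (\<lambda>i. \<alpha> k i \<omega>) (\<lambda>i. w k i \<omega>) n = 0" for n
      by (simp add: noise_sum_def)
    then have "noise_quad lam (\<lambda>i. \<alpha> k i \<omega>) (\<lambda>i. w k i \<omega>) n = 0" for n
      by (simp add: noise_quad_def)
    then show ?case
      using elim True by (intro allI impI covered_of_noise) auto
  qed
  then have "AE \<omega> in M. \<omega> \<notin> A - {\<omega> \<in> space M. \<forall>n\<ge>1. covered k n \<omega>}"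
    using AE_space by eventually_elim auto
  then have "A - {\<omega> \<in> space M. \<forall>n\<ge>1. covered k n \<omega>} \<in> null_sets M"
    by (rule AE_iff_null_sets[OF sets.Diff[OF AM covered_event], THEN iffD2])
  then have "emeasure M (A - {\<omega> \<in> space M. \<forall>n\<ge>1. covered k n \<omega>}) = 0"
    by (rule null_setsD1)
  then show ?thesis by simp
next
  case False
  then have \<sigma>: "0 < \<sigma>" using pos(2) by simp
  have sp: "A \<subseteq> space M" using sets.sets_into_space[OF A] by simp
  have AM: "A \<in> sets M" using A subalgebra_Filt[of k 0] by (auto simp: subalgebra_def)
  \<comment> \<open>Written as \<open>2 / (\<delta> / 2)\<close> to match
    \<open>subgaussian_tail\<close> at level \<open>\<delta> / 2\<close>; this is the constant
    \<open>4 / \<delta>\<close> of \<open>radius\<close>.\<close>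
  let ?B1 = "{\<omega> \<in> A. \<sigma> * sqrt (2 * ln (2 / (\<delta> / 2))) < \<bar>w k 1 \<omega>\<bar>}"
  let ?B2 = "{\<omega> \<in> A. \<exists>n\<ge>1. 2 / \<delta> \<le> mixture \<sigma> lam (\<lambda>i. \<alpha> k i \<omega>) (\<lambda>i. w k i \<omega>) n}"
  have "w k 1 \<in> borel_measurable M" by (rule noise_measurable) simp
  then have B1: "?B1 \<in> sets M" using AM by measurable
  have mix: "(\<lambda>\<omega>. mixture \<sigma> lam (\<lambda>i. \<alpha> k i \<omega>) (\<lambda>i. w k i \<omega>) n) \<in> borel_measurable M" if "1 \<le> n" for n
    by (rule measurable_from_subalg[OF subalgebra_Filt mixture_Filt[OF that order_refl]])
  have "?B2 = (\<Union>n\<in>{1..}. A \<inter> {\<omega> \<in> space M. 2 / \<delta> \<le> mixture \<sigma> lam (\<lambda>i. \<alpha> k i \<omega>) (\<lambda>i. w k i \<omega>) n})"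
    using sp by auto
  also have "\<dots> \<in> sets M"
    using AM by (intro sets.countable_UN'' sets.Int borel_measurable_le borel_measurable_const mix) auto
  finally have B2: "?B2 \<in> sets M" .
  have "A - {\<omega> \<in> space M. \<forall>n\<ge>1. covered k n \<omega>} \<subseteq> ?B1 \<union> ?B2"
  proof
    fix \<omega> assume "\<omega> \<in> A - {\<omega> \<in> space M. \<forall>n\<ge>1. covered k n \<omega>}"
    then obtain n where \<omega>: "\<omega> \<in> A" "\<omega> \<in> space M" and n: "1 \<le> n" "\<not> covered k n \<omega>"
      using sp by auto
    show "\<omega> \<in> ?B1 \<union> ?B2"
    proof (rule ccontr)
      assume no: "\<omega> \<notin> ?B1 \<union> ?B2"
      then have "\<not> 2 / \<delta> \<le> mixture \<sigma> lam (\<lambda>i. \<alpha> k i \<omega>) (\<lambda>i. w k i \<omega>) n"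
        using \<omega>(1) n(1) by blast
      then have "mixture \<sigma> lam (\<lambda>i. \<alpha> k i \<omega>) (\<lambda>i. w k i \<omega>) n \<le> 2 / \<delta>"
        by simp
      moreover have "\<bar>w k 1 \<omega>\<bar> \<le> \<sigma> * sqrt (2 * ln (4 / \<delta>))"
        using no \<omega> by (simp add: not_less)
      ultimately have "covered k n \<omega>"
        using noise_quad_le[OF pos(3) n(1) \<sigma> pos(4)] covered_of_noise[OF \<omega>(2) n(1)] by blast
      with n(2) show False ..
    qed
  qed
  then have "emeasure M (A - {\<omega> \<in> space M. \<forall>n\<ge>1. covered k n \<omega>}) \<le> emeasure M (?B1 \<union> ?B2)"
    by (rule emeasure_mono) (rule sets.Un[OF B1 B2])
  also have "\<dots> \<le> emeasure M ?B1 + emeasure M ?B2"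
    by (rule emeasure_subadditive[OF B1 B2])
  also have "\<dots> \<le> ennreal (\<delta> / 2) * emeasure M A + ennreal (\<delta> / 2) * emeasure M A"
  proof (rule add_mono[OF _ mixture_maximal[OF \<sigma> A]])
    have "subgaussian_given M (Filt k 0) \<sigma> (w k 1)"
      using noise_given[of 1 k] by simp
    then show "emeasure M ?B1 \<le> ennreal (\<delta> / 2) * emeasure M A"
      by (rule subgaussian_tail[OF M subalgebra_Filt _ A \<sigma>]) (use pos in simp_all)
  qed
  also have "\<dots> = ennreal \<delta> * emeasure M A"
    using pos(4) by (simp flip: distrib_right ennreal_plus)
  finally show ?thesis .
qed

end

theorem theorem1:
  fixes M H :: "'w measure"
    and F :: "real^2 \<Rightarrow> real" and pstar :: "real^2" and G L M3 \<Delta>0 \<rho> \<sigma> lam \<delta> :: real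
    and p :: "nat \<Rightarrow> 'w \<Rightarrow> real^2" and \<theta> :: "nat \<Rightarrow> 'w \<Rightarrow> real"
    and \<alpha> w y :: "nat \<Rightarrow> nat \<Rightarrow> 'w \<Rightarrow> real" and \<tau> :: "nat \<Rightarrow> 'w \<Rightarrow> enat" and k :: nat
  assumes "prob_space M" and "subalgebra M H"
    and field: "\<And>\<omega>. \<omega> \<in> space M \<Longrightarrow> field_assumption F (p 0 \<omega>) pstar G L M3 \<Delta>0"
    and "0 < \<rho>" and "0 \<le> \<sigma>" and "0 < lam" and "0 < \<delta>" and "\<delta> < 1"
    and measurement: "\<And>j i \<omega>. 1 \<le> i \<Longrightarrow> \<omega> \<in> space M \<Longrightarrow>
           y j i \<omega> = F (p j \<omega> + \<rho> *\<^sub>R phi (\<theta> j \<omega> + \<alpha> j i \<omega>)) + w j i \<omega>"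
    and scan_length: "\<And>j. scan_stopping_time (info M H \<tau> \<alpha> y j) (\<tau> j)"
    and position: "\<And>j. p j \<in> borel_measurable (info M H \<tau> \<alpha> y j 0)"
    and heading: "\<And>j. \<theta> j \<in> borel_measurable (info M H \<tau> \<alpha> y j 0)"
    and bearing: "\<And>j i. 1 \<le> i \<Longrightarrow> \<alpha> j i \<in> borel_measurable (info M H \<tau> \<alpha> y j (i - 1))"
    and noise_integrable: "\<And>j i. 1 \<le> i \<Longrightarrow> integrable M (w j i)"
    and noise_mean: "\<And>j i. 1 \<le> i \<Longrightarrow>
           AE \<omega> in M. real_cond_exp M (info M H \<tau> \<alpha> y j (i - 1)) (w j i) \<omega> = 0"
    and noise_subgaussian: "\<And>j i s. 1 \<le> i \<Longrightarrow>
           AE \<omega> in M. nn_cond_exp M (info M H \<tau> \<alpha> y j (i - 1)) (\<lambda>\<omega>. ennreal (exp (s * w j i \<omega>))) \<omega>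
             \<le> ennreal (exp (s^2 * \<sigma>^2 / 2))"
  shows "let
      covered = (\<lambda>n \<omega>. local_grad F (p k \<omega>) (\<theta> k \<omega>)
        \<in> conf_set \<rho> lam \<sigma> G L M3 \<delta> (\<lambda>i. \<alpha> k i \<omega>) (\<lambda>i. y k i \<omega>) n);
      E = {\<omega> \<in> space M. \<forall>n\<ge>1. covered n \<omega>}
    in E \<in> sets M
       \<and> (AE \<omega> in M. real_cond_exp M (info M H \<tau> \<alpha> y k 0) (indicator E) \<omega> \<ge> 1 - \<delta>)
       \<and> (\<forall>T. scan_stopping_time (info M H \<tau> \<alpha> y k) T \<longrightarrow>
             (\<forall>\<omega>\<in>E. \<forall>n\<ge>1. T \<omega> = enat n \<longrightarrow> covered n \<omega>))"
proof -
  interpret scan_model M H F pstar G L M3 \<Delta>0 \<rho> \<sigma> lam \<delta> p \<theta> \<alpha> w y \<tau>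
    by (rule scan_model.intro)
      (fact assms | (rule borel_measurable_integrable, rule noise_integrable, assumption))+
  have bound: "AE \<omega> in M. 1 - \<delta> \<le> real_cond_exp M (Filt k 0) (indicator {\<omega> \<in> space M. \<forall>n\<ge>1. covered k n \<omega>}) \<omega>"
    by (rule real_cond_exp_indicator_ge[OF M subalgebra_Filt covered_event pos(4) not_covered_emeasure_le])
  show ?thesis
    \<comment> \<open>On the event all samples are covered at once, so the claim on stopping times
      holds pointwise.\<close>
    unfolding Let_def covered_def[symmetric] by (intro conjI covered_event bound) blast
qed

end
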